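(* Let $G$ and $H$ be equivalent locally compact Hausdorff groupoids with open range and source maps, and assume that $G$ has abelian isotropy (so that $H$ has abelian isotropy as well). Then $G$ is proper modulo its isotropy if and only if $H$ is proper modulo its isotropy.
   Context: Groupoids are topological groupoids, not assumed second countable and not assumed to have Haar systems. $G^{(0)}$ is the unit space of $G$, and $r,s:G\to G^{(0)}$ are the range and source maps. Actions: a left action of $G$ on a space $P$ consists of a continuous moment map $r_P:P\to G^{(0)}$ and a continuous map $(\gamma,p)\mapsto\gamma\cdot p$ from $G*P=\{(\gamma,p): s(\gamma)=r_P(p)\}$ to $P$ with $r_P(\gamma\cdot p)=r(\gamma)$, $r_P(p)\cdot p=p$ and $\gamma\cdot(\eta\cdot p)=(\gamma\eta)\cdot p$ for composable $\gamma,\eta$. The action is free if $\gamma\cdot p=p$ only when $\gamma=r_P(p)$. It is proper if the map $\Theta:G*P\to P\times P$, $\Theta(\gamma,p)=(\gamma\cdot p,p)$, is proper (preimages of compact sets are compact). Right actions are defined similarly, with moment map $s_P$. Equivalence: $G$ and $H$ are equivalent if there is a $(G,H)$-equivalence, i.e. a locally compact Hausdorff space $Z$ such that: (E1) $Z$ is a free and proper left $G$-space; (E2) $Z$ is a free and proper right $H$-space; (E3) the two actions commute; (E4) the moment map $r_Z:Z\to G^{(0)}$ is open and induces a homeomorphism $Z/H\to G^{(0)}$; (E5) the moment map $s_Z:Z\to H^{(0)}$ is open and induces a homeomorphism $G\backslash Z\to H^{(0)}$. For $u\in G^{(0)}$ the isotropy group is $G(u)=\{\gamma\in G: r(\gamma)=u=s(\gamma)\}$;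 $G$ has abelian isotropy if every $G(u)$ is abelian. The orbit space $G\backslash G^{(0)}$ is the quotient of $G^{(0)}$ by the relation $r(\gamma)\sim s(\gamma)$, with the quotient topology. Let $\Sigma_0$ be the set of closed subgroups of $G$, i.e. closed subsets of $G$ that are subgroups of $G(u)$ for some $u\in G^{(0)}$, with the relative topology from the Fell topology on the set $\mathcal C(G)$ of all closed subsets of $G$ (basic open sets: $\{F: F\cap K=\emptyset,\ F\cap U_i\neq\emptyset\ (1\le i\le n)\}$ with $K\subset G$ compact and $U_1,\dots,U_n\subset G$ open). Let $p_0:\Sigma_0\to G^{(0)}$ be $p_0(A)=u$ when $A\subset G(u)$. Let $\pi:G\to G^{(0)}\times G^{(0)}$, $\pi(\gamma)=(r(\gamma),s(\gamma))$, and let $R=\pi(G)$ with the relative product topology, a topological groupoid (equivalence relation) on $G^{(0)}$. If $G$ has abelian isotropy, $R$ acts on $\Sigma_0$, with moment map $p_0$, by the well-defined formula $\pi(\gamma)\cdot A=\gamma A\gamma^{-1}$ for $p_0(A)=s(\gamma)$. $R$ acts continuously on $\Sigma_0$ if the map $(\pi(\gamma),A)\mapsto\gamma A\gamma^{-1}$ from $\{(\pi(\gamma),A)\in R\times\Sigma_0: s(\gamma)=p_0(A)\}$ to $\Sigma_0$ is continuous. $G$ is proper modulo its isotropy if $G$ has abelian isotropy, $G\backslash G^{(0)}$ is Hausdorff, and $R$ acts continuously on $\Sigma_0$. *)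

theory Defs
  imports "HOL-Analysis.Analysis"
begin

section \<open>Topological groupoids\<close>

text \<open>
  A groupoid is carried by the points of an abstract topology.  The record fields are total
  functions; their values are meaningful only for arrows in \<open>topspace (gtop G)\<close>, and
  \<open>gmul G x y\<close> only for composable pairs, i.e. when \<open>gsrc G x = grng G y\<close>.
  The unit space is a subspace of the space of arrows.
\<close>

record 'g groupoid =
  gtop :: "'g topology"
  grng :: "'g \<Rightarrow> 'g"
  gsrc :: "'g \<Rightarrow> 'g"
  gmul :: "'g \<Rightarrow> 'g \<Rightarrow> 'g"
  ginv :: "'g \<Rightarrow> 'g"

abbreviation arrows :: "'g groupoid \<Rightarrow> 'g set" where
  "arrows G \<equiv> topspace (gtop G)"

definition units :: "'g groupoid \<Rightarrow> 'g set" where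
  "units G = grng G ` arrows G"

definition unit_space :: "'g groupoid \<Rightarrow> 'g topology" where
  "unit_space G = subtopology (gtop G) (units G)"

definition composable :: "'g groupoid \<Rightarrow> ('g \<times> 'g) set" where
  "composable G = {(x, y). x \<in> arrows G \<and> y \<in> arrows G \<and> gsrc G x = grng G y}"

locale topological_groupoid =
  fixes G :: "'g groupoid"
  assumes rng_in: "x \<in> arrows G \<Longrightarrow> grng G x \<in> arrows G"
    and src_in: "x \<in> arrows G \<Longrightarrow> gsrc G x \<in> units G"
    and rng_unit: "u \<in> units G \<Longrightarrow> grng G u = u"
    and src_unit: "u \<in> units G \<Longrightarrow> gsrc G u = u"
    and mul_in: "(x, y) \<in> composable G \<Longrightarrow> gmul G x y \<in> arrows G"
    and rng_mul: "(x, y) \<in> composable G \<Longrightarrow> grng G (gmul G x y) = grng G x"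
    and src_mul: "(x, y) \<in> composable G \<Longrightarrow> gsrc G (gmul G x y) = gsrc G y"
    and mul_assoc: "\<lbrakk>(x, y) \<in> composable G; (y, z) \<in> composable G\<rbrakk>
      \<Longrightarrow> gmul G (gmul G x y) z = gmul G x (gmul G y z)"
    and unit_mul: "x \<in> arrows G \<Longrightarrow> gmul G (grng G x) x = x"
    and mul_unit: "x \<in> arrows G \<Longrightarrow> gmul G x (gsrc G x) = x"
    and inv_in: "x \<in> arrows G \<Longrightarrow> ginv G x \<in> arrows G"
    and rng_inv: "x \<in> arrows G \<Longrightarrow> grng G (ginv G x) = gsrc G x"
    and src_inv: "x \<in> arrows G \<Longrightarrow> gsrc G (ginv G x) = grng G x"
    and mul_inv: "x \<in> arrows G \<Longrightarrow> gmul G x (ginv G x) = grng G x"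
    and inv_mul: "x \<in> arrows G \<Longrightarrow> gmul G (ginv G x) x = gsrc G x"
    and continuous_rng: "continuous_map (gtop G) (unit_space G) (grng G)"
    and continuous_src: "continuous_map (gtop G) (unit_space G) (gsrc G)"
    and continuous_mul:
      "continuous_map (subtopology (prod_topology (gtop G) (gtop G)) (composable G)) (gtop G)
        (\<lambda>(x, y). gmul G x y)"
    and continuous_inv: "continuous_map (gtop G) (gtop G) (ginv G)"

locale lch_open_groupoid = topological_groupoid G for G :: "'g groupoid" +
  assumes locally_compact: "locally_compact_space (gtop G)"
    and Hausdorff: "Hausdorff_space (gtop G)"
    and open_rng: "open_map (gtop G) (unit_space G) (grng G)"
    and open_src: "open_map (gtop G) (unit_space G) (gsrc G)"


section \<open>Quotient spaces\<close>

text \<open>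
  The quotient of the space \<open>X\<close> by a relation \<open>E\<close>, which is meant to be an
  equivalence relation on \<open>topspace X\<close>; its points are the equivalence classes.
\<close>

definition quotient_space :: "'a topology \<Rightarrow> ('a \<times> 'a) set \<Rightarrow> 'a set topology" where
  "quotient_space X E = topology (\<lambda>\<U>. \<U> \<subseteq> topspace X // E \<and>
     openin X {x \<in> topspace X. E `` {x} \<in> \<U>})"

lemma openin_quotient_space:
  "openin (quotient_space X E) \<U> \<longleftrightarrow>
     \<U> \<subseteq> topspace X // E \<and> openin X {x \<in> topspace X. E `` {x} \<in> \<U>}"
proof -
  have "istopology (\<lambda>\<U>. \<U> \<subseteq> topspace X // E \<and> openin X {x \<in> topspace X. E `` {x} \<in> \<U>})"
    (is "istopology ?P")
    unfolding istopology_def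
  proof (intro conjI allI impI)
    fix S T assume "?P S" "?P T"
    moreover have "{x \<in> topspace X. E `` {x} \<in> S \<inter> T} =
        {x \<in> topspace X. E `` {x} \<in> S} \<inter> {x \<in> topspace X. E `` {x} \<in> T}"
      by blast
    ultimately show "S \<inter> T \<subseteq> topspace X // E"
      and "openin X {x \<in> topspace X. E `` {x} \<in> S \<inter> T}"
      by auto
  next
    fix \<K> assume K: "\<forall>S\<in>\<K>. ?P S"
    show "\<Union>\<K> \<subseteq> topspace X // E" using K by blast
    have "{x \<in> topspace X. E `` {x} \<in> \<Union>\<K>} = (\<Union>S\<in>\<K>. {x \<in> topspace X. E `` {x} \<in> S})"
      by blast
    then show "openin X {x \<in> topspace X. E `` {x} \<in> \<Union>\<K>}"
      using K by auto
  qed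
  then show ?thesis
    by (simp add: quotient_space_def topology_inverse')
qed

lemma topspace_quotient_space: "topspace (quotient_space X E) = topspace X // E"
proof -
  have "{x \<in> topspace X. E `` {x} \<in> topspace X // E} = topspace X"
    by (auto simp: quotient_def)
  then have "openin (quotient_space X E) (topspace X // E)"
    by (simp add: openin_quotient_space)
  then show ?thesis
    using openin_subset[of "quotient_space X E"] openin_quotient_space[of X E "topspace (quotient_space X E)"] by auto
qed


section \<open>Actions and equivalence of groupoids\<close>

definition left_fibre_product ::
  "'g groupoid \<Rightarrow> 'p topology \<Rightarrow> ('p \<Rightarrow> 'g) \<Rightarrow> ('g \<times> 'p) set" where
  "left_fibre_product G P \<rho> =
     {(x, p). x \<in> arrows G \<and> p \<in> topspace P \<and> gsrc G x = \<rho> p}"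

locale left_action =
  fixes G :: "'g groupoid" and P :: "'p topology"
    and \<rho> :: "'p \<Rightarrow> 'g" and act :: "'g \<Rightarrow> 'p \<Rightarrow> 'p"
  assumes continuous_moment: "continuous_map P (unit_space G) \<rho>"
    and continuous_act:
      "continuous_map (subtopology (prod_topology (gtop G) P) (left_fibre_product G P \<rho>)) P
        (\<lambda>(x, p). act x p)"
    and moment_act: "(x, p) \<in> left_fibre_product G P \<rho> \<Longrightarrow> \<rho> (act x p) = grng G x"
    and unit_act: "p \<in> topspace P \<Longrightarrow> act (\<rho> p) p = p"
    and act_act: "\<lbrakk>(x, y) \<in> composable G; (y, p) \<in> left_fibre_product G P \<rho>\<rbrakk>
      \<Longrightarrow> act x (act y p) = act (gmul G x y) p"

locale free_proper_left_action = left_action +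
  assumes free: "\<lbrakk>(x, p) \<in> left_fibre_product G P \<rho>; act x p = p\<rbrakk> \<Longrightarrow> x = \<rho> p"
    and proper: "compactin (prod_topology P P) K \<Longrightarrow>
      compactin (subtopology (prod_topology (gtop G) P) (left_fibre_product G P \<rho>))
        {(x, p) \<in> left_fibre_product G P \<rho>. (act x p, p) \<in> K}"

definition right_fibre_product ::
  "'h groupoid \<Rightarrow> 'p topology \<Rightarrow> ('p \<Rightarrow> 'h) \<Rightarrow> ('p \<times> 'h) set" where
  "right_fibre_product H P \<sigma> =
     {(p, y). p \<in> topspace P \<and> y \<in> arrows H \<and> \<sigma> p = grng H y}"

locale right_action =
  fixes H :: "'h groupoid" and P :: "'p topology"
    and \<sigma> :: "'p \<Rightarrow> 'h" and act :: "'p \<Rightarrow> 'h \<Rightarrow> 'p"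
  assumes continuous_moment: "continuous_map P (unit_space H) \<sigma>"
    and continuous_act:
      "continuous_map (subtopology (prod_topology P (gtop H)) (right_fibre_product H P \<sigma>)) P
        (\<lambda>(p, y). act p y)"
    and moment_act: "(p, y) \<in> right_fibre_product H P \<sigma> \<Longrightarrow> \<sigma> (act p y) = gsrc H y"
    and act_unit: "p \<in> topspace P \<Longrightarrow> act p (\<sigma> p) = p"
    and act_act: "\<lbrakk>(p, x) \<in> right_fibre_product H P \<sigma>; (x, y) \<in> composable H\<rbrakk>
      \<Longrightarrow> act (act p x) y = act p (gmul H x y)"

locale free_proper_right_action = right_action +
  assumes free: "\<lbrakk>(p, y) \<in> right_fibre_product H P \<sigma>; act p y = p\<rbrakk> \<Longrightarrow> y = \<sigma> p"
    and proper: "compactin (prod_topology P P) K \<Longrightarrow>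
      compactin (subtopology (prod_topology P (gtop H)) (right_fibre_product H P \<sigma>))
        {(p, y) \<in> right_fibre_product H P \<sigma>. (p, act p y) \<in> K}"

definition left_orbit_rel ::
  "'g groupoid \<Rightarrow> 'p topology \<Rightarrow> ('p \<Rightarrow> 'g) \<Rightarrow> ('g \<Rightarrow> 'p \<Rightarrow> 'p) \<Rightarrow> ('p \<times> 'p) set" where
  "left_orbit_rel G P \<rho> act = {(p, act x p) | x p. (x, p) \<in> left_fibre_product G P \<rho>}"

definition right_orbit_rel ::
  "'h groupoid \<Rightarrow> 'p topology \<Rightarrow> ('p \<Rightarrow> 'h) \<Rightarrow> ('p \<Rightarrow> 'h \<Rightarrow> 'p) \<Rightarrow> ('p \<times> 'p) set" where
  "right_orbit_rel H P \<sigma> act = {(p, act p y) | p y. (p, y) \<in> right_fibre_product H P \<sigma>}"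

definition induces_homeomorphism ::
  "'p topology \<Rightarrow> ('p \<times> 'p) set \<Rightarrow> 'b topology \<Rightarrow> ('p \<Rightarrow> 'b) \<Rightarrow> bool" where
  "induces_homeomorphism P E B f \<longleftrightarrow>
     (\<exists>\<phi>. homeomorphic_map (quotient_space P E) B \<phi> \<and> (\<forall>p \<in> topspace P. \<phi> (E `` {p}) = f p))"

text \<open>
  That the two actions commute includes that each moment map is invariant under the other action;
  this is what makes both sides of \<open>commute\<close> defined.
\<close>

locale groupoid_equivalence =
  left: free_proper_left_action G Z \<rho> lact + right: free_proper_right_action H Z \<sigma> ract
  for G :: "'g groupoid" and H :: "'h groupoid" and Z :: "'z topology"
    and \<rho> :: "'z \<Rightarrow> 'g" and lact :: "'g \<Rightarrow> 'z \<Rightarrow> 'z"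
    and \<sigma> :: "'z \<Rightarrow> 'h" and ract :: "'z \<Rightarrow> 'h \<Rightarrow> 'z" +
  assumes locally_compact: "locally_compact_space Z"
    and Hausdorff: "Hausdorff_space Z"
    and src_moment_lact: "(x, z) \<in> left_fibre_product G Z \<rho> \<Longrightarrow> \<sigma> (lact x z) = \<sigma> z"
    and rng_moment_ract: "(z, y) \<in> right_fibre_product H Z \<sigma> \<Longrightarrow> \<rho> (ract z y) = \<rho> z"
    and commute: "\<lbrakk>(x, z) \<in> left_fibre_product G Z \<rho>; (z, y) \<in> right_fibre_product H Z \<sigma>\<rbrakk>
      \<Longrightarrow> ract (lact x z) y = lact x (ract z y)"
    and open_rng_moment: "open_map Z (unit_space G) \<rho>"
    and homeo_rng_moment:
      "induces_homeomorphism Z (right_orbit_rel H Z \<sigma> ract) (unit_space G) \<rho>"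
    and open_src_moment: "open_map Z (unit_space H) \<sigma>"
    and homeo_src_moment:
      "induces_homeomorphism Z (left_orbit_rel G Z \<rho> lact) (unit_space H) \<sigma>"


section \<open>Isotropy and the Fell topology\<close>

definition isotropy :: "'g groupoid \<Rightarrow> 'g \<Rightarrow> 'g set" where
  "isotropy G u = {x \<in> arrows G. grng G x = u \<and> gsrc G x = u}"

definition abelian_isotropy :: "'g groupoid \<Rightarrow> bool" where
  "abelian_isotropy G \<longleftrightarrow>
     (\<forall>u \<in> units G. \<forall>x \<in> isotropy G u. \<forall>y \<in> isotropy G u. gmul G x y = gmul G y x)"

definition orbit_space :: "'g groupoid \<Rightarrow> 'g set topology" where
  "orbit_space G = quotient_space (unit_space G) {(grng G x, gsrc G x) | x. x \<in> arrows G}"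

definition fell_topology :: "'a topology \<Rightarrow> 'a set topology" where
  "fell_topology X = topology_generated_by
     {{F. closedin X F \<and> F \<inter> K = {} \<and> (\<forall>U \<in> \<U>. F \<inter> U \<noteq> {})} | K \<U>.
        compactin X K \<and> finite \<U> \<and> (\<forall>U \<in> \<U>. openin X U)}"

definition isotropy_subgroup :: "'g groupoid \<Rightarrow> 'g \<Rightarrow> 'g set \<Rightarrow> bool" where
  "isotropy_subgroup G u A \<longleftrightarrow> A \<subseteq> isotropy G u \<and> u \<in> A \<and>
     (\<forall>x \<in> A. \<forall>y \<in> A. gmul G x y \<in> A) \<and> (\<forall>x \<in> A. ginv G x \<in> A)"

definition closed_subgroups :: "'g groupoid \<Rightarrow> 'g set set" where
  "closed_subgroups G = {A. closedin (gtop G) A \<and> (\<exists>u \<in> units G. isotropy_subgroup G u A)}"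

definition subgroup_space :: "'g groupoid \<Rightarrow> 'g set topology" where
  "subgroup_space G = subtopology (fell_topology (gtop G)) (closed_subgroups G)"

definition base_point :: "'g groupoid \<Rightarrow> 'g set \<Rightarrow> 'g" where
  "base_point G A = (THE u. u \<in> units G \<and> A \<subseteq> isotropy G u)"

definition orbit_pair :: "'g groupoid \<Rightarrow> 'g \<Rightarrow> 'g \<times> 'g" where
  "orbit_pair G x = (grng G x, gsrc G x)"

definition orbit_relation_space :: "'g groupoid \<Rightarrow> ('g \<times> 'g) topology" where
  "orbit_relation_space G =
     subtopology (prod_topology (unit_space G) (unit_space G)) (orbit_pair G ` arrows G)"

definition conjugate :: "'g groupoid \<Rightarrow> 'g \<Rightarrow> 'g set \<Rightarrow> 'g set" where
  "conjugate G x A = (\<lambda>a. gmul G (gmul G x a) (ginv G x)) ` A"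

text \<open>
  The action of the orbit relation on closed subgroups.  The description is unique when the
  isotropy is abelian (see \<open>orbit_relation_act_eq\<close> below).
\<close>

definition orbit_relation_act :: "'g groupoid \<Rightarrow> 'g \<times> 'g \<Rightarrow> 'g set \<Rightarrow> 'g set" where
  "orbit_relation_act G e A =
     (THE B. \<exists>x \<in> arrows G. orbit_pair G x = e \<and> B = conjugate G x A)"

definition orbit_relation_acts_continuously :: "'g groupoid \<Rightarrow> bool" where
  "orbit_relation_acts_continuously G \<longleftrightarrow>
     continuous_map
       (subtopology (prod_topology (orbit_relation_space G) (subgroup_space G))
         {(e, A). snd e = base_point G A})
       (subgroup_space G)
       (\<lambda>(e, A). orbit_relation_act G e A)"

definition proper_modulo_isotropy :: "'g groupoid \<Rightarrow> bool" where
  "proper_modulo_isotropy G \<longleftrightarrow>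
     abelian_isotropy G \<and> Hausdorff_space (orbit_space G) \<and> orbit_relation_acts_continuously G"

context topological_groupoid
begin

lemma base_point_eq:
  assumes "u \<in> units G" and "isotropy_subgroup G u A"
  shows "base_point G A = u"
  unfolding base_point_def
  using assms by (intro the_equality) (auto simp: isotropy_subgroup_def isotropy_def)

lemma orbit_relation_act_eq:
  assumes "abelian_isotropy G" and "x \<in> arrows G" and "A \<subseteq> isotropy G (gsrc G x)"
  shows "orbit_relation_act G (orbit_pair G x) A = conjugate G x A"
proof -
  have "conjugate G y A = conjugate G x A"
    if y: "y \<in> arrows G" "grng G y = grng G x" "gsrc G y = gsrc G x" for y
    unfolding conjugate_def
  proof (rule image_cong[OF refl])
    fix a assume "a \<in> A"
    then have a: "a \<in> arrows G" "grng G a = gsrc G x" "gsrc G a = gsrc G x"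
      using assms(3) by (auto simp: isotropy_def)
    note x = assms(2)
    let ?c = "gmul G (ginv G x) y"
    note closed = mul_in rng_mul src_mul inv_in rng_inv src_inv
    note co = composable_def
    have c: "?c \<in> arrows G" "grng G ?c = gsrc G x" "gsrc G ?c = gsrc G x"
      using x y by (auto simp: co closed)
    have u: "gsrc G x \<in> units G" using x by (rule src_in)
    have comm: "gmul G ?c a = gmul G a ?c"
      using assms(1) u a c by (auto simp: abelian_isotropy_def isotropy_def)
    have xc: "gmul G x ?c = y"
      using x y mul_assoc[of x "ginv G x" y] mul_inv[of x] unit_mul[of y]
      by (simp add: co closed)
    have cy: "gmul G ?c (ginv G y) = ginv G x"
      using x y mul_assoc[of "ginv G x" y "ginv G y"] mul_inv[of y] mul_unit[of "ginv G x"]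
      by (simp add: co closed)
    have "gmul G y a = gmul G x (gmul G ?c a)"
      using x a c mul_assoc[of x ?c a] xc by (simp add: co)
    also have "\<dots> = gmul G (gmul G x a) ?c"
      using x a c mul_assoc[of x a ?c] comm by (simp add: co)
    finally have "gmul G (gmul G y a) (ginv G y) = gmul G (gmul G (gmul G x a) ?c) (ginv G y)"
      by simp
    also have "\<dots> = gmul G (gmul G x a) (gmul G ?c (ginv G y))"
      using x y a c by (intro mul_assoc) (auto simp: co closed)
    finally show "gmul G (gmul G y a) (ginv G y) = gmul G (gmul G x a) (ginv G x)"
      using cy by simp
  qed
  then have unique: "B = conjugate G x A"
    if "\<exists>y \<in> arrows G. orbit_pair G y = orbit_pair G x \<and> B = conjugate G y A" for B
    using that unfolding orbit_pair_def by blast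
  show ?thesis
    unfolding orbit_relation_act_def
  proof (rule the_equality)
    show "\<exists>y \<in> arrows G. orbit_pair G y = orbit_pair G x \<and> conjugate G x A = conjugate G y A"
      using assms(2) by blast
  qed (rule unique)
qed

end

end

theory Submission
  imports Defs
begin

text \<open>
  A point \<open>z\<close> of the equivalence \<open>Z\<close> identifies the isotropy groups \<open>G(\<rho> z)\<close> and
  \<open>H(\<sigma> z)\<close> through \<open>a z = z b\<close>.  Properness of the two actions makes the induced map
  \<open>(z, A) \<mapsto> transport z ` A\<close> on closed subgroups continuous for the Fell topologies.  Moving \<open>z\<close>
  changes the identification by conjugation, so for abelian isotropy the action of the
  orbit relation of \<open>H\<close>, pulled back along the open surjection \<open>\<sigma> \<times> \<sigma> \<times> id\<close>, is a composite
  of such maps with the action of the orbit relation of \<open>G\<close>.  The orbit spaces of \<open>G\<close> and \<open>H\<close>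
  are both the space of orbits of the commuting actions on \<open>Z\<close>.  Passing to the opposite actions
  exchanges \<open>G\<close> and \<open>H\<close>, so one implication suffices.
\<close>

section \<open>Preliminaries on topologies\<close>

text \<open>The orbit relation carries the product topology, which can be strictly coarser than the
  quotient topology from the groupoid. Continuity of conjugation by arrows therefore does not
  descend to it, and in general there is no continuous choice of an arrow over a pair of equivalent
  units. The equivalence avoids this choice: a pair \<open>(z, w)\<close> over
  \<open>(\<sigma> z, \<sigma> w)\<close> already determines the pair
  \<open>(\<rho> z, \<rho> w)\<close>, on which the other orbit relation is assumed to act
  continuously. The base point of a subgroup moves together with \<open>z\<close>, so the Fell
  estimates must be uniform in \<open>z\<close>. The two properness conditions do different work
  there: that of the right action makes \<open>transport z a\<close> jointly continuous in
  \<open>z\<close> and \<open>a\<close>; that of the left action confines the elements which points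
  of a compact set transport into a compact set. Freeness makes the transported element
  unique.\<close>

lemma subtopology_cong_Int:
  "topspace X \<inter> S = topspace X \<inter> T \<Longrightarrow> subtopology X S = subtopology X T"
  by (metis subtopology_restrict)

text \<open>Products of quotient maps need not be quotient maps, whereas products of open maps are
  open: a box around a point of \<open>W\<close> inside \<open>W\<close> has a box as image. This
  yields the openness of \<open>\<sigma> \<times> \<sigma> \<times> id\<close>.\<close>

lemma open_map_map_prod:
  assumes "open_map X X' f" and "open_map Y Y' g"
  shows "open_map (prod_topology X Y) (prod_topology X' Y') (map_prod f g)"
  unfolding open_map_def
proof (intro allI impI)
  fix W assume W: "openin (prod_topology X Y) W"
  show "openin (prod_topology X' Y') (map_prod f g ` W)"
    unfolding openin_prod_topology_alt
  proof (intro allI impI)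
    fix x' y' assume "(x', y') \<in> map_prod f g ` W"
    then obtain x y where xy: "(x, y) \<in> W" "x' = f x" "y' = g y"
      by auto
    then obtain U V where UV: "openin X U" "openin Y V" "x \<in> U" "y \<in> V" "U \<times> V \<subseteq> W"
      using W unfolding openin_prod_topology_alt by metis
    have "f ` U \<times> g ` V \<subseteq> map_prod f g ` W"
      using UV(5) by force
    moreover have "openin X' (f ` U)" "openin Y' (g ` V)"
      using assms UV by (auto simp: open_map_def)
    ultimately show "\<exists>U V. openin X' U \<and> openin Y' V \<and> x' \<in> U \<and> y' \<in> V \<and> U \<times> V \<subseteq> map_prod f g ` W"
      using xy UV by blast
  qed
qed

section \<open>The Fell topology: miss sets, hit sets and continuity into it\<close>

lemma topspace_fell_topology: "topspace (fell_topology X) = {F. closedin X F}"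
proof -
  have "{F. closedin X F} \<in> {{F. closedin X F \<and> F \<inter> K = {} \<and> (\<forall>U \<in> \<U>. F \<inter> U \<noteq> {})} | K \<U>.
        compactin X K \<and> finite \<U> \<and> (\<forall>U \<in> \<U>. openin X U)}"
    by (intro CollectI exI[of _ "{}"]) auto
  then show ?thesis
    unfolding fell_topology_def by auto
qed

lemma openin_fell_miss:
  assumes "compactin X K"
  shows "openin (fell_topology X) {F. closedin X F \<and> F \<inter> K = {}}"
  unfolding fell_topology_def
  using assms by (intro topology_generated_by_Basis CollectI exI[of _ K] exI[of _ "{}"]) auto

lemma openin_fell_hit:
  assumes "openin X U"
  shows "openin (fell_topology X) {F. closedin X F \<and> F \<inter> U \<noteq> {}}"
  unfolding fell_topology_def
  using assms by (intro topology_generated_by_Basis CollectI exI[of _ "{}"] exI[of _ "{U}"]) auto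

text \<open>A generating set of the Fell topology is one miss set intersected with finitely many hit
  sets, so the two kinds can be tested separately. For transported subgroups they need different
  arguments: joint continuity for hitting, compactness for missing.\<close>

lemma continuous_map_into_fell:
  assumes closed: "\<And>x. x \<in> topspace T \<Longrightarrow> closedin X (f x)"
    and miss: "\<And>K. compactin X K \<Longrightarrow> openin T {x \<in> topspace T. f x \<inter> K = {}}"
    and hit: "\<And>U. openin X U \<Longrightarrow> openin T {x \<in> topspace T. f x \<inter> U \<noteq> {}}"
  shows "continuous_map T (fell_topology X) f"
  unfolding fell_topology_def
proof (rule continuous_on_generated_topo)
  fix \<B> assume "\<B> \<in> {{F. closedin X F \<and> F \<inter> K = {} \<and> (\<forall>U \<in> \<U>. F \<inter> U \<noteq> {})} | K \<U>.
        compactin X K \<and> finite \<U> \<and> (\<forall>U \<in> \<U>. openin X U)}"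
  then obtain K \<U> where K: "compactin X K" and \<U>: "finite \<U>" "\<forall>U \<in> \<U>. openin X U"
    and \<B>: "\<B> = {F. closedin X F \<and> F \<inter> K = {} \<and> (\<forall>U \<in> \<U>. F \<inter> U \<noteq> {})}"
    by blast
  have "openin T ({x \<in> topspace T. f x \<inter> K = {}} \<inter> {x \<in> topspace T. \<forall>U \<in> \<U>. f x \<inter> U \<noteq> {}})"
  proof (rule openin_Int[OF miss[OF K]])
    show "openin T {x \<in> topspace T. \<forall>U \<in> \<U>. f x \<inter> U \<noteq> {}}"
      using \<U>
    proof (induction \<U>)
      case (insert U \<U>)
      have eq: "{x \<in> topspace T. \<forall>U \<in> insert U \<U>. f x \<inter> U \<noteq> {}} =
          {x \<in> topspace T. f x \<inter> U \<noteq> {}} \<inter> {x \<in> topspace T. \<forall>U \<in> \<U>. f x \<inter> U \<noteq> {}}"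
        by auto
      show ?case
        unfolding eq by (rule openin_Int) (use insert hit in simp_all)
    qed simp
  qed
  also have "{x \<in> topspace T. f x \<inter> K = {}} \<inter> {x \<in> topspace T. \<forall>U \<in> \<U>. f x \<inter> U \<noteq> {}} = f -` \<B> \<inter> topspace T"
    using closed by (auto simp: \<B>)
  finally show "openin T (f -` \<B> \<inter> topspace T)" .
next
  have "f ` topspace T \<subseteq> topspace (fell_topology X)"
    using closed by (auto simp: topspace_fell_topology)
  then show "f ` topspace T \<subseteq> \<Union> {{F. closedin X F \<and> F \<inter> K = {} \<and> (\<forall>U \<in> \<U>. F \<inter> U \<noteq> {})} | K \<U>.
        compactin X K \<and> finite \<U> \<and> (\<forall>U \<in> \<U>. openin X U)}"
    by (simp add: fell_topology_def)
qed


section \<open>Groupoids and their actions\<close>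

context topological_groupoid
begin

lemma units_arrows: "u \<in> units G \<Longrightarrow> u \<in> arrows G"
  using rng_in by (auto simp: units_def)

lemma rng_units: "x \<in> arrows G \<Longrightarrow> grng G x \<in> units G"
  by (simp add: units_def)

lemma topspace_unit_space: "topspace (unit_space G) = units G"
  using units_arrows by (auto simp: unit_space_def)

lemmas arrow_simps = mul_in rng_mul src_mul inv_in rng_inv src_inv mul_inv inv_mul
  rng_unit src_unit rng_units src_in units_arrows unit_mul mul_unit composable_def

lemma inv_unique:
  assumes "x \<in> arrows G" "y \<in> arrows G" "gsrc G x = grng G y" "gmul G x y = grng G x"
  shows "y = ginv G x"
proof -
  have "gmul G (gmul G (ginv G x) x) y = gmul G (ginv G x) (gmul G x y)"
    using assms by (intro mul_assoc) (auto simp: arrow_simps)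
  then show ?thesis
    using assms mul_unit[of "ginv G x"] by (simp add: arrow_simps)
qed

lemma inv_inv: "x \<in> arrows G \<Longrightarrow> ginv G (ginv G x) = x"
  by (rule inv_unique[symmetric]) (auto simp: arrow_simps)

lemma inv_unit: "u \<in> units G \<Longrightarrow> ginv G u = u"
  using mul_unit[of u] by (intro inv_unique[symmetric]) (auto simp: arrow_simps)

lemma mul_inv_cancel:
  assumes "x \<in> arrows G" "y \<in> arrows G" "gsrc G x = grng G y"
  shows "gmul G (gmul G x y) (ginv G y) = x"
  using assms mul_assoc[of x y "ginv G y"] mul_unit[of x] by (simp add: arrow_simps)

lemma inv_mul_distrib:
  assumes "x \<in> arrows G" "y \<in> arrows G" "gsrc G x = grng G y"
  shows "ginv G (gmul G x y) = gmul G (ginv G y) (ginv G x)"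
proof (rule inv_unique[symmetric])
  have "gmul G (gmul G x y) (gmul G (ginv G y) (ginv G x)) =
      gmul G (gmul G (gmul G x y) (ginv G y)) (ginv G x)"
    using assms by (intro mul_assoc[symmetric]) (auto simp: arrow_simps)
  then show "gmul G (gmul G x y) (gmul G (ginv G y) (ginv G x)) = grng G (gmul G x y)"
    using assms by (simp add: mul_inv_cancel) (simp add: arrow_simps)
qed (use assms in \<open>auto simp: arrow_simps\<close>)

text \<open>Freeness speaks about arrows that fix a point. This lemma turns its conclusion for
  \<open>x y^-1\<close> into an equation between \<open>x\<close> and \<open>y\<close>.\<close>

lemma eq_of_mul_inv_unit:
  assumes "x \<in> arrows G" "y \<in> arrows G" "grng G x = grng G y" "gsrc G x = gsrc G y"
    and "gmul G x (ginv G y) = grng G x"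
  shows "x = y"
  using inv_unique[of x "ginv G y"] assms inv_inv[of x] inv_inv[of y] by (simp add: arrow_simps)

lemma inv_isotropy: "a \<in> isotropy G u \<Longrightarrow> ginv G a \<in> isotropy G u"
  by (auto simp: isotropy_def arrow_simps)

lemma conjugate_isotropy:
  assumes "x \<in> arrows G" "A \<subseteq> isotropy G (gsrc G x)"
  shows "conjugate G x A \<subseteq> isotropy G (grng G x)"
  using assms by (auto simp: conjugate_def isotropy_def arrow_simps)

end

section \<open>Opposite actions and the opposite equivalence\<close>

lemma free_proper_left_action_opposite:
  assumes H: "topological_groupoid H" and act: "free_proper_right_action H P \<sigma> act"
  shows "free_proper_left_action H P \<sigma> (\<lambda>y p. act p (ginv H y))"
proof -
  interpret H: topological_groupoid H by (rule H)
  interpret free_proper_right_action H P \<sigma> act by (rule act)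
  let ?L = "subtopology (prod_topology (gtop H) P) (left_fibre_product H P \<sigma>)"
  let ?R = "subtopology (prod_topology P (gtop H)) (right_fibre_product H P \<sigma>)"
  have LR: "(p, ginv H y) \<in> right_fibre_product H P \<sigma>" if "(y, p) \<in> left_fibre_product H P \<sigma>" for y p
    using that by (auto simp: left_fibre_product_def right_fibre_product_def H.arrow_simps)
  have RL: "(ginv H y, p) \<in> left_fibre_product H P \<sigma>" if "(p, y) \<in> right_fibre_product H P \<sigma>" for y p
    using that by (auto simp: left_fibre_product_def right_fibre_product_def H.arrow_simps)
  have in_H: "y \<in> arrows H" if "(y, p) \<in> left_fibre_product H P \<sigma>" for y p
    using that by (auto simp: left_fibre_product_def)
  have swap: "continuous_map ?L ?R (\<lambda>(y, p). (p, ginv H y))"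
    unfolding case_prod_beta
    by (intro continuous_map_into_subtopology continuous_map_pairedI continuous_map_from_subtopology)
      (use LR in \<open>auto intro: continuous_map_snd continuous_map_compose[OF continuous_map_fst H.continuous_inv, unfolded o_def]\<close>)
  have swap': "continuous_map ?R ?L (\<lambda>(p, y). (ginv H y, p))"
    unfolding case_prod_beta
    by (intro continuous_map_into_subtopology continuous_map_pairedI continuous_map_from_subtopology)
      (use RL in \<open>auto intro: continuous_map_fst continuous_map_compose[OF continuous_map_snd H.continuous_inv, unfolded o_def]\<close>)
  show ?thesis
  proof
    show "continuous_map P (unit_space H) \<sigma>" by (rule continuous_moment)
    show "continuous_map ?L P (\<lambda>(y, p). act p (ginv H y))"
      using continuous_map_compose[OF swap continuous_act] by (simp add: o_def case_prod_unfold)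
    show "\<sigma> (act p (ginv H y)) = grng H y" if "(y, p) \<in> left_fibre_product H P \<sigma>" for y p
      using moment_act[OF LR[OF that]] in_H[OF that] by (simp add: H.arrow_simps)
    show "act p (ginv H (\<sigma> p)) = p" if "p \<in> topspace P" for p
    proof -
      have "\<sigma> p \<in> units H"
        using continuous_moment that H.topspace_unit_space by (auto simp: continuous_map_def)
      then show ?thesis
        using that by (simp add: H.inv_unit act_unit)
    qed
    show "act (act p (ginv H y)) (ginv H x) = act p (ginv H (gmul H x y))"
      if "(x, y) \<in> composable H" "(y, p) \<in> left_fibre_product H P \<sigma>" for x y p
      using act_act[OF LR[OF that(2)], of "ginv H x"] that(1)
      by (auto simp: H.inv_mul_distrib composable_def H.inv_in H.rng_inv H.src_inv)
    show "y = \<sigma> p" if "(y, p) \<in> left_fibre_product H P \<sigma>" "act p (ginv H y) = p" for y p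
    proof -
      have "ginv H y = \<sigma> p"
        using free[OF LR[OF that(1)] that(2)] .
      moreover have "\<sigma> p \<in> units H"
        using that(1) by (auto simp: left_fibre_product_def H.src_in dest: sym)
      ultimately show ?thesis
        using H.inv_inv[OF in_H[OF that(1)]] by (simp add: H.inv_unit)
    qed
    \<comment> \<open>The left properness map is \<open>(p y^-1, p)\<close>, the right one is
      \<open>(p, p y)\<close>. Swapping the two factors of \<open>K\<close> and inverting the arrow
      turns one preimage into the other.\<close>
    fix K assume K: "compactin (prod_topology P P) K"
    then have "compactin (prod_topology P P) ((\<lambda>(p, q). (q, p)) ` K)"
      by (rule image_compactin) (simp add: case_prod_unfold continuous_map_pairedI continuous_map_fst continuous_map_snd)
    from image_compactin[OF proper[OF this] swap']
    have "compactin ?L ((\<lambda>(p, y). (ginv H y, p)) `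
        {(p, y) \<in> right_fibre_product H P \<sigma>. (p, act p y) \<in> (\<lambda>(p, q). (q, p)) ` K})" .
    also have "(\<lambda>(p, y). (ginv H y, p)) `
        {(p, y) \<in> right_fibre_product H P \<sigma>. (p, act p y) \<in> (\<lambda>(p, q). (q, p)) ` K} =
        {(y, p) \<in> left_fibre_product H P \<sigma>. (act p (ginv H y), p) \<in> K}" (is "?A = ?B")
    proof (intro equalityI subsetI)
      fix e assume "e \<in> ?A"
      then obtain p y where e: "e = (ginv H y, p)" "(p, y) \<in> right_fibre_product H P \<sigma>" "(act p y, p) \<in> K"
        by auto
      then have "ginv H (ginv H y) = y"
        by (auto simp: right_fibre_product_def H.inv_inv)
      then show "e \<in> ?B"
        using e RL by simp
    next
      fix e assume "e \<in> ?B"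
      then obtain p y where e: "e = (y, p)" "(y, p) \<in> left_fibre_product H P \<sigma>" "(act p (ginv H y), p) \<in> K"
        by auto
      then show "e \<in> ?A"
        using LR in_H by (intro image_eqI[of _ _ "(p, ginv H y)"]) (auto simp: H.inv_inv image_iff intro!: bexI[of _ "(act p (ginv H y), p)"])
    qed
    finally show "compactin ?L {(y, p) \<in> left_fibre_product H P \<sigma>. (act p (ginv H y), p) \<in> K}" .
  qed
qed

lemma free_proper_right_action_opposite:
  assumes G: "topological_groupoid G" and act: "free_proper_left_action G P \<rho> act"
  shows "free_proper_right_action G P \<rho> (\<lambda>p x. act (ginv G x) p)"
proof -
  interpret G: topological_groupoid G by (rule G)
  interpret free_proper_left_action G P \<rho> act by (rule act)
  let ?L = "subtopology (prod_topology (gtop G) P) (left_fibre_product G P \<rho>)"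
  let ?R = "subtopology (prod_topology P (gtop G)) (right_fibre_product G P \<rho>)"
  have LR: "(p, ginv G x) \<in> right_fibre_product G P \<rho>" if "(x, p) \<in> left_fibre_product G P \<rho>" for x p
    using that by (auto simp: left_fibre_product_def right_fibre_product_def G.arrow_simps)
  have RL: "(ginv G x, p) \<in> left_fibre_product G P \<rho>" if "(p, x) \<in> right_fibre_product G P \<rho>" for x p
    using that by (auto simp: left_fibre_product_def right_fibre_product_def G.arrow_simps)
  have in_G: "x \<in> arrows G" if "(p, x) \<in> right_fibre_product G P \<rho>" for x p
    using that by (auto simp: right_fibre_product_def)
  have swap: "continuous_map ?L ?R (\<lambda>(x, p). (p, ginv G x))"
    unfolding case_prod_beta
    by (intro continuous_map_into_subtopology continuous_map_pairedI continuous_map_from_subtopology)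
      (use LR in \<open>auto intro: continuous_map_snd continuous_map_compose[OF continuous_map_fst G.continuous_inv, unfolded o_def]\<close>)
  have swap': "continuous_map ?R ?L (\<lambda>(p, x). (ginv G x, p))"
    unfolding case_prod_beta
    by (intro continuous_map_into_subtopology continuous_map_pairedI continuous_map_from_subtopology)
      (use RL in \<open>auto intro: continuous_map_fst continuous_map_compose[OF continuous_map_snd G.continuous_inv, unfolded o_def]\<close>)
  show ?thesis
  proof
    show "continuous_map P (unit_space G) \<rho>" by (rule continuous_moment)
    show "continuous_map ?R P (\<lambda>(p, x). act (ginv G x) p)"
      using continuous_map_compose[OF swap' continuous_act] by (simp add: o_def case_prod_unfold)
    show "\<rho> (act (ginv G x) p) = gsrc G x" if "(p, x) \<in> right_fibre_product G P \<rho>" for x p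
      using moment_act[OF RL[OF that]] in_G[OF that] by (simp add: G.arrow_simps)
    show "act (ginv G (\<rho> p)) p = p" if "p \<in> topspace P" for p
    proof -
      have "\<rho> p \<in> units G"
        using continuous_moment that G.topspace_unit_space by (auto simp: continuous_map_def)
      then show ?thesis
        using that by (simp add: G.inv_unit unit_act)
    qed
    show "act (ginv G y) (act (ginv G x) p) = act (ginv G (gmul G x y)) p"
      if "(p, x) \<in> right_fibre_product G P \<rho>" "(x, y) \<in> composable G" for x y p
      using act_act[OF _ RL[OF that(1)], of "ginv G y"] that(2)
      by (auto simp: G.inv_mul_distrib composable_def G.inv_in G.rng_inv G.src_inv)
    show "x = \<rho> p" if "(p, x) \<in> right_fibre_product G P \<rho>" "act (ginv G x) p = p" for x p
    proof -
      have "ginv G x = \<rho> p"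
        using free[OF RL[OF that(1)] that(2)] .
      moreover have "\<rho> p \<in> units G"
        using that(1) by (auto simp: right_fibre_product_def G.rng_units dest: sym)
      ultimately show ?thesis
        using G.inv_inv[OF in_G[OF that(1)]] by (simp add: G.inv_unit)
    qed
    fix K assume K: "compactin (prod_topology P P) K"
    then have "compactin (prod_topology P P) ((\<lambda>(p, q). (q, p)) ` K)"
      by (rule image_compactin) (simp add: case_prod_unfold continuous_map_pairedI continuous_map_fst continuous_map_snd)
    from image_compactin[OF proper[OF this] swap]
    have "compactin ?R ((\<lambda>(x, p). (p, ginv G x)) `
        {(x, p) \<in> left_fibre_product G P \<rho>. (act x p, p) \<in> (\<lambda>(p, q). (q, p)) ` K})" .
    also have "(\<lambda>(x, p). (p, ginv G x)) `
        {(x, p) \<in> left_fibre_product G P \<rho>. (act x p, p) \<in> (\<lambda>(p, q). (q, p)) ` K} =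
        {(p, x) \<in> right_fibre_product G P \<rho>. (p, act (ginv G x) p) \<in> K}" (is "?A = ?B")
    proof (intro equalityI subsetI)
      fix e assume "e \<in> ?A"
      then obtain p x where e: "e = (p, ginv G x)" "(x, p) \<in> left_fibre_product G P \<rho>" "(p, act x p) \<in> K"
        by auto
      then have "ginv G (ginv G x) = x"
        by (auto simp: left_fibre_product_def G.inv_inv)
      then show "e \<in> ?B"
        using e LR by simp
    next
      fix e assume "e \<in> ?B"
      then obtain p x where e: "e = (p, x)" "(p, x) \<in> right_fibre_product G P \<rho>" "(p, act (ginv G x) p) \<in> K"
        by auto
      then show "e \<in> ?A"
        using RL in_G by (intro image_eqI[of _ _ "(ginv G x, p)"]) (auto simp: G.inv_inv image_iff intro!: bexI[of _ "(p, act (ginv G x) p)"])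
    qed
    finally show "compactin ?R {(p, x) \<in> right_fibre_product G P \<rho>. (p, act (ginv G x) p) \<in> K}" .
  qed
qed

lemma left_orbit_rel_opposite:
  assumes "topological_groupoid H"
  shows "left_orbit_rel H P \<sigma> (\<lambda>y p. act p (ginv H y)) = right_orbit_rel H P \<sigma> act"
proof -
  interpret H: topological_groupoid H by (rule assms)
  have "\<exists>y'. act p (ginv H y) = act p y' \<and> (p, y') \<in> right_fibre_product H P \<sigma>"
    if "(y, p) \<in> left_fibre_product H P \<sigma>" for y p
    using that by (intro exI[of _ "ginv H y"])
      (auto simp: left_fibre_product_def right_fibre_product_def H.inv_in H.rng_inv)
  moreover have "\<exists>y'. act p y = act p (ginv H y') \<and> (y', p) \<in> left_fibre_product H P \<sigma>"
    if "(p, y) \<in> right_fibre_product H P \<sigma>" for y p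
    using that by (intro exI[of _ "ginv H y"])
      (auto simp: left_fibre_product_def right_fibre_product_def H.inv_in H.src_inv H.inv_inv)
  ultimately show ?thesis
    unfolding left_orbit_rel_def right_orbit_rel_def by blast
qed

lemma right_orbit_rel_opposite:
  assumes "topological_groupoid G"
  shows "right_orbit_rel G P \<rho> (\<lambda>p x. act (ginv G x) p) = left_orbit_rel G P \<rho> act"
proof -
  interpret G: topological_groupoid G by (rule assms)
  have "\<exists>y'. act y p = act (ginv G y') p \<and> (p, y') \<in> right_fibre_product G P \<rho>"
    if "(y, p) \<in> left_fibre_product G P \<rho>" for y p
    using that by (intro exI[of _ "ginv G y"])
      (auto simp: left_fibre_product_def right_fibre_product_def G.inv_in G.rng_inv G.inv_inv)
  moreover have "\<exists>y'. act (ginv G y) p = act y' p \<and> (y', p) \<in> left_fibre_product G P \<rho>"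
    if "(p, y) \<in> right_fibre_product G P \<rho>" for y p
    using that by (intro exI[of _ "ginv G y"])
      (auto simp: left_fibre_product_def right_fibre_product_def G.inv_in G.src_inv)
  ultimately show ?thesis
    unfolding left_orbit_rel_def right_orbit_rel_def by blast
qed

text \<open>Inversion permutes the arrows, so the opposite actions have the original orbit relations
  and the conditions on the two moment maps are exchanged. The commutation law is symmetric in the
  two actions.\<close>

lemma groupoid_equivalence_opposite:
  assumes G: "topological_groupoid G" and H: "topological_groupoid H"
    and eq: "groupoid_equivalence G H Z \<rho> lact \<sigma> ract"
  shows "groupoid_equivalence H G Z \<sigma> (\<lambda>y z. ract z (ginv H y)) \<rho> (\<lambda>z x. lact (ginv G x) z)"
proof -
  interpret G: topological_groupoid G by (rule G)
  interpret H: topological_groupoid H by (rule H)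
  interpret groupoid_equivalence G H Z \<rho> lact \<sigma> ract by (rule eq)
  have L: "(ginv G x, z) \<in> left_fibre_product G Z \<rho>" if "(z, x) \<in> right_fibre_product G Z \<rho>" for x z
    using that by (auto simp: left_fibre_product_def right_fibre_product_def G.arrow_simps)
  have R: "(z, ginv H y) \<in> right_fibre_product H Z \<sigma>" if "(y, z) \<in> left_fibre_product H Z \<sigma>" for y z
    using that by (auto simp: left_fibre_product_def right_fibre_product_def H.arrow_simps)
  show ?thesis
  proof (intro groupoid_equivalence.intro groupoid_equivalence_axioms.intro)
    show "free_proper_left_action H Z \<sigma> (\<lambda>y z. ract z (ginv H y))"
      by (rule free_proper_left_action_opposite[OF H right.free_proper_right_action_axioms])
    show "free_proper_right_action G Z \<rho> (\<lambda>z x. lact (ginv G x) z)"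
      by (rule free_proper_right_action_opposite[OF G left.free_proper_left_action_axioms])
    show "\<rho> (ract z (ginv H x)) = \<rho> z" if "(x, z) \<in> left_fibre_product H Z \<sigma>" for x z
      using rng_moment_ract[OF R[OF that]] .
    show "\<sigma> (lact (ginv G y) z) = \<sigma> z" if "(z, y) \<in> right_fibre_product G Z \<rho>" for y z
      using src_moment_lact[OF L[OF that]] .
    show "lact (ginv G y) (ract z (ginv H x)) = ract (lact (ginv G y) z) (ginv H x)"
      if "(x, z) \<in> left_fibre_product H Z \<sigma>" "(z, y) \<in> right_fibre_product G Z \<rho>" for x y z
      using commute[OF L[OF that(2)] R[OF that(1)]] by simp
    show "induces_homeomorphism Z (right_orbit_rel G Z \<rho> (\<lambda>z x. lact (ginv G x) z)) (unit_space H) \<sigma>"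
      using homeo_src_moment by (simp add: right_orbit_rel_opposite[OF G])
    show "induces_homeomorphism Z (left_orbit_rel H Z \<sigma> (\<lambda>y z. ract z (ginv H y))) (unit_space G) \<rho>"
      using homeo_rng_moment by (simp add: left_orbit_rel_opposite[OF H])
  qed (fact locally_compact Hausdorff open_src_moment open_rng_moment)+
qed


section \<open>Isotropy groups along an equivalence\<close>

locale lch_groupoid_equivalence =
  G: lch_open_groupoid G + H: lch_open_groupoid H + groupoid_equivalence G H Z \<rho> lact \<sigma> ract
  for G :: "'g groupoid" and H :: "'h groupoid" and Z :: "'z topology"
    and \<rho> :: "'z \<Rightarrow> 'g" and lact :: "'g \<Rightarrow> 'z \<Rightarrow> 'z"
    and \<sigma> :: "'z \<Rightarrow> 'h" and ract :: "'z \<Rightarrow> 'h \<Rightarrow> 'z"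
begin

abbreviation "lact' \<equiv> \<lambda>y z. ract z (ginv H y)"
abbreviation "ract' \<equiv> \<lambda>z x. lact (ginv G x) z"

lemma opposite: "lch_groupoid_equivalence H G Z \<sigma> lact' \<rho> ract'"
  by (intro lch_groupoid_equivalence.intro G.lch_open_groupoid_axioms H.lch_open_groupoid_axioms
      groupoid_equivalence_opposite G.topological_groupoid_axioms H.topological_groupoid_axioms
      groupoid_equivalence_axioms)

lemma rho_unit: "z \<in> topspace Z \<Longrightarrow> \<rho> z \<in> units G"
  using left.continuous_moment G.topspace_unit_space by (auto simp: continuous_map_def)

lemma sigma_unit: "z \<in> topspace Z \<Longrightarrow> \<sigma> z \<in> units H"
  using right.continuous_moment H.topspace_unit_space by (auto simp: continuous_map_def)

lemma lact_closed:
  assumes "x \<in> arrows G" "z \<in> topspace Z" "gsrc G x = \<rho> z"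
  shows "lact x z \<in> topspace Z" "\<rho> (lact x z) = grng G x" "\<sigma> (lact x z) = \<sigma> z"
proof -
  have xz: "(x, z) \<in> left_fibre_product G Z \<rho>"
    using assms by (simp add: left_fibre_product_def)
  then show "\<rho> (lact x z) = grng G x" "\<sigma> (lact x z) = \<sigma> z"
    by (simp_all add: left.moment_act src_moment_lact)
  show "lact x z \<in> topspace Z"
    using continuous_map_image_subset_topspace[OF left.continuous_act] xz assms by force
qed

lemma ract_closed:
  assumes "y \<in> arrows H" "z \<in> topspace Z" "grng H y = \<sigma> z"
  shows "ract z y \<in> topspace Z" "\<sigma> (ract z y) = gsrc H y" "\<rho> (ract z y) = \<rho> z"
proof -
  have zy: "(z, y) \<in> right_fibre_product H Z \<sigma>"
    using assms by (simp add: right_fibre_product_def)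
  then show "\<sigma> (ract z y) = gsrc H y" "\<rho> (ract z y) = \<rho> z"
    by (simp_all add: right.moment_act rng_moment_ract)
  show "ract z y \<in> topspace Z"
    using continuous_map_image_subset_topspace[OF right.continuous_act] zy assms by force
qed

lemma lact_mul:
  assumes "x \<in> arrows G" "y \<in> arrows G" "gsrc G x = grng G y" "z \<in> topspace Z" "gsrc G y = \<rho> z"
  shows "lact (gmul G x y) z = lact x (lact y z)"
  using assms left.act_act[of x y z] by (simp add: composable_def left_fibre_product_def)

lemma ract_mul:
  assumes "x \<in> arrows H" "y \<in> arrows H" "gsrc H x = grng H y" "z \<in> topspace Z" "grng H x = \<sigma> z"
  shows "ract z (gmul H x y) = ract (ract z x) y"
  using assms right.act_act[of z x y] by (simp add: composable_def right_fibre_product_def)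

lemma lact_ract:
  assumes "x \<in> arrows G" "gsrc G x = \<rho> z" "y \<in> arrows H" "grng H y = \<sigma> z" "z \<in> topspace Z"
  shows "lact x (ract z y) = ract (lact x z) y"
  using assms commute[of x z y] by (simp add: left_fibre_product_def right_fibre_product_def)

lemma lact_inv:
  assumes "x \<in> arrows G" "z \<in> topspace Z" "gsrc G x = \<rho> z"
  shows "lact (ginv G x) (lact x z) = z"
  using assms lact_mul[of "ginv G x" x z] left.unit_act[of z] by (simp add: G.arrow_simps)

lemma ract_inv:
  assumes "y \<in> arrows H" "z \<in> topspace Z" "grng H y = \<sigma> z"
  shows "ract (ract z y) (ginv H y) = z"
  using assms ract_mul[of y "ginv H y" z] right.act_unit[of z] by (simp add: H.arrow_simps)

section \<open>The fibres of \<open>\<rho>\<close> as orbits of the free and proper action of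
  \<open>H\<close>\<close>

lemma rho_surj: "\<rho> ` topspace Z = units G"
proof -
  let ?E = "right_orbit_rel H Z \<sigma> ract"
  obtain \<phi> where "homeomorphic_map (quotient_space Z ?E) (unit_space G) \<phi>"
    and \<phi>: "\<forall>z \<in> topspace Z. \<phi> (?E `` {z}) = \<rho> z"
    using homeo_rng_moment unfolding induces_homeomorphism_def by blast
  then have "\<phi> ` (topspace Z // ?E) = units G"
    using homeomorphic_imp_surjective_map topspace_quotient_space G.topspace_unit_space by metis
  moreover have "topspace Z // ?E = (\<lambda>z. ?E `` {z}) ` topspace Z"
    by (auto simp: quotient_def)
  ultimately have "(\<lambda>z. \<phi> (?E `` {z})) ` topspace Z = units G"
    by (simp add: image_image)
  then show ?thesis
    using \<phi> by simp
qed

text \<open>This is the injective half of the bijection from orbits of \<open>H\<close> to units of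
  \<open>G\<close>: each fibre of \<open>\<rho>\<close> is a single orbit.\<close>

lemma ract_transitive:
  assumes "z \<in> topspace Z" "w \<in> topspace Z" "\<rho> z = \<rho> w"
  obtains y where "y \<in> arrows H" "grng H y = \<sigma> z" "ract z y = w"
proof -
  let ?E = "right_orbit_rel H Z \<sigma> ract"
  obtain \<phi> where \<phi>: "homeomorphic_map (quotient_space Z ?E) (unit_space G) \<phi>"
      "\<forall>z \<in> topspace Z. \<phi> (?E `` {z}) = \<rho> z"
    using homeo_rng_moment unfolding induces_homeomorphism_def by blast
  have "inj_on \<phi> (topspace Z // ?E)"
    using homeomorphic_imp_injective_map[OF \<phi>(1)] by (simp add: topspace_quotient_space)
  then have "?E `` {z} = ?E `` {w}"
    by (rule inj_onD) (use \<phi>(2) assms in \<open>auto simp: quotient_def\<close>)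
  \<comment> \<open>The class of \<open>w\<close> contains \<open>w\<close> because the unit
    \<open>\<sigma> w\<close> fixes it; equality of the classes then puts \<open>w\<close> into the
    class of \<open>z\<close>.\<close>
  moreover have "(w, \<sigma> w) \<in> right_fibre_product H Z \<sigma>"
    using assms(2) sigma_unit by (auto simp: right_fibre_product_def H.arrow_simps)
  then have "(w, w) \<in> ?E"
    using right.act_unit[OF assms(2)] unfolding right_orbit_rel_def by force
  ultimately have "(z, w) \<in> ?E"
    by blast
  then show thesis
    using that unfolding right_orbit_rel_def right_fibre_product_def by auto
qed

text \<open>Applying \<open>\<sigma>\<close> to \<open>z x = z y\<close> shows that \<open>x\<close>
  and \<open>y\<close> have the same source. Hence \<open>x y^-1\<close> is defined and fixes
  \<open>z\<close>, and freeness makes it a unit.\<close>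

lemma ract_inject:
  assumes "x \<in> arrows H" "y \<in> arrows H" "grng H x = \<sigma> z" "grng H y = \<sigma> z" "z \<in> topspace Z"
    and "ract z x = ract z y"
  shows "x = y"
proof -
  have src: "gsrc H x = gsrc H y"
    using assms ract_closed(2) by metis
  then have "ract z (gmul H x (ginv H y)) = ract (ract z y) (ginv H y)"
    using assms by (simp add: ract_mul H.arrow_simps)
  also have "\<dots> = z"
    using assms by (simp add: ract_inv)
  finally have fix_z: "ract z (gmul H x (ginv H y)) = z" .
  have "(z, gmul H x (ginv H y)) \<in> right_fibre_product H Z \<sigma>"
    using assms(1-5) src by (simp add: right_fibre_product_def H.arrow_simps)
  then have "gmul H x (ginv H y) = \<sigma> z"
    using fix_z by (rule right.free)
  then show ?thesis
    using assms src by (simp add: H.eq_of_mul_inv_unit)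
qed

text \<open>The division map of the action of \<open>H\<close>. The description is meaningful for
  \<open>\<rho> z = \<rho> w\<close>: existence is \<open>ract_transitive\<close>, uniqueness is
  \<open>ract_inject\<close>.\<close>

definition translation :: "'z \<Rightarrow> 'z \<Rightarrow> 'h" where
  "translation z w = (THE y. y \<in> arrows H \<and> grng H y = \<sigma> z \<and> ract z y = w)"

lemma translation_eq:
  assumes "y \<in> arrows H" "grng H y = \<sigma> z" "z \<in> topspace Z"
  shows "translation z (ract z y) = y"
  unfolding translation_def by (rule the_equality) (use assms ract_inject in auto)

text \<open>Properness of the action makes \<open>(z, y) \<mapsto> (z, z y)\<close> a closed embedding.\<close>

lemma continuous_translation:
  "continuous_map (subtopology (prod_topology Z Z) {(z, w). \<rho> z = \<rho> w}) (gtop H)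
    (\<lambda>(z, w). translation z w)"
proof -
  define X where "X = subtopology (prod_topology Z (gtop H)) (right_fibre_product H Z \<sigma>)"
  define f where "f = (\<lambda>(z, y). (z, ract z y))"
  have tX: "topspace X = right_fibre_product H Z \<sigma>"
    by (auto simp: X_def right_fibre_product_def)
  have cont: "continuous_map X (prod_topology Z Z) f"
    unfolding f_def case_prod_unfold
    by (intro continuous_map_pairedI)
      (use right.continuous_act in \<open>auto simp: X_def case_prod_unfold intro: continuous_map_from_subtopology continuous_map_fst\<close>)
  \<comment> \<open>Properness of the action is stated through compact preimages, whereas
    \<open>proper_map\<close> means closed with compact fibres. The former gives the latter because
    \<open>Z \<times> Z\<close> is locally compact Hausdorff, hence a k-space in which compact sets
    are closed.\<close>
  have "proper_map X (prod_topology Z Z) f"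
  proof (rule compact_imp_proper_map)
    show "k_space (prod_topology Z Z)"
      by (intro locally_compact_imp_k_space) (simp add: locally_compact_space_prod_topology locally_compact)
    show "kc_space (prod_topology Z Z)"
      by (intro Hausdorff_imp_kc_space) (simp add: Hausdorff_space_prod_topology Hausdorff)
    show "f \<in> topspace X \<rightarrow> topspace (prod_topology Z Z)"
      using cont by (simp add: continuous_map_def)
    show "continuous_map X (prod_topology Z Z) f \<or> kc_space X"
      using cont by blast
    show "compactin X {e \<in> topspace X. f e \<in> K}" if "compactin (prod_topology Z Z) K" for K
    proof -
      have "{e \<in> topspace X. f e \<in> K} = {(z, y) \<in> right_fibre_product H Z \<sigma>. (z, ract z y) \<in> K}"
        by (auto simp: tX f_def)
      then show ?thesis
        using right.proper[OF that] by (simp add: X_def)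
    qed
  qed
  moreover have "inj_on f (topspace X)"
    unfolding tX f_def inj_on_def right_fibre_product_def by clarsimp (metis ract_inject)
  ultimately have "embedding_map X (prod_topology Z Z) f"
    using cont by (intro injective_closed_imp_embedding_map) (auto simp: proper_map_def)
  \<comment> \<open>Transitivity on the fibres of \<open>\<rho>\<close> identifies the image of the
    embedding. The inverse is thus defined on all pairs with \<open>\<rho> z = \<rho> w\<close>, and
    its second coordinate is \<open>translation\<close>.\<close>
  moreover have "f ` topspace X = topspace (prod_topology Z Z) \<inter> {(z, w). \<rho> z = \<rho> w}" (is "?A = ?B")
  proof (intro equalityI subsetI)
    fix e assume "e \<in> ?A"
    then show "e \<in> ?B"
      by (auto simp: tX f_def right_fibre_product_def ract_closed)
  next
    fix e assume "e \<in> ?B"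
    then obtain z w where e: "e = (z, w)" "z \<in> topspace Z" "w \<in> topspace Z" "\<rho> z = \<rho> w"
      by auto
    then obtain y where "y \<in> arrows H" "grng H y = \<sigma> z" "ract z y = w"
      using ract_transitive by metis
    then show "e \<in> ?A"
      using e by (intro image_eqI[of _ _ "(z, y)"]) (auto simp: tX f_def right_fibre_product_def)
  qed
  ultimately have "homeomorphic_map X (subtopology (prod_topology Z Z) {(z, w). \<rho> z = \<rho> w}) f"
    unfolding embedding_map_def by (metis subtopology_restrict)
  then obtain g where g: "homeomorphic_maps X (subtopology (prod_topology Z Z) {(z, w). \<rho> z = \<rho> w}) f g"
    using homeomorphic_map_maps by blast
  have "continuous_map (subtopology (prod_topology Z Z) {(z, w). \<rho> z = \<rho> w}) (gtop H) (snd \<circ> g)"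
  proof (rule continuous_map_compose)
    show "continuous_map (subtopology (prod_topology Z Z) {(z, w). \<rho> z = \<rho> w}) X g"
      using g by (simp add: homeomorphic_maps_def)
    show "continuous_map X (gtop H) snd"
      by (simp add: X_def continuous_map_from_subtopology continuous_map_snd)
  qed
  then show ?thesis
  proof (rule continuous_map_eq)
    fix e assume e: "e \<in> topspace (subtopology (prod_topology Z Z) {(z, w). \<rho> z = \<rho> w})"
    then have "f (g e) = e" "g e \<in> topspace X"
      using g by (auto simp: homeomorphic_maps_def continuous_map_def)
    then show "(snd \<circ> g) e = (\<lambda>(z, w). translation z w) e"
      using translation_eq by (cases "g e") (auto simp: f_def tX right_fibre_product_def)
  qed
qed

section \<open>The isomorphism of isotropy groups attached to a point of \<open>Z\<close>\<close>

definition transport :: "'z \<Rightarrow> 'g \<Rightarrow> 'h" where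
  "transport z a = translation z (lact a z)"

text \<open>The points \<open>z\<close> and \<open>a z\<close> lie in one fibre of
  \<open>\<rho>\<close>, so \<open>a z = z b\<close> for some \<open>b\<close>. Its source is
  \<open>\<sigma> (a z)\<close>, which equals \<open>\<sigma> z\<close> because
  \<open>\<sigma>\<close> is invariant under \<open>G\<close>; hence \<open>b\<close> is
  isotropy.\<close>

lemma transport:
  assumes "z \<in> topspace Z" "a \<in> isotropy G (\<rho> z)"
  shows "transport z a \<in> isotropy H (\<sigma> z)" "ract z (transport z a) = lact a z"
proof -
  have a: "a \<in> arrows G" "grng G a = \<rho> z" "gsrc G a = \<rho> z"
    using assms(2) by (auto simp: isotropy_def)
  then have "lact a z \<in> topspace Z" "\<rho> z = \<rho> (lact a z)"
    using assms(1) by (simp_all add: lact_closed)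
  then obtain y where y: "y \<in> arrows H" "grng H y = \<sigma> z" "ract z y = lact a z"
    by (rule ract_transitive[OF assms(1)])
  then have "gsrc H y = \<sigma> z"
    using ract_closed[of y z] lact_closed[of a z] assms(1) a by simp
  moreover have "transport z a = y"
    using translation_eq[of y z] y assms(1) by (simp add: transport_def)
  ultimately show "transport z a \<in> isotropy H (\<sigma> z)" "ract z (transport z a) = lact a z"
    using y by (auto simp: isotropy_def)
qed

lemma transport_eqI:
  assumes "z \<in> topspace Z" "b \<in> isotropy H (\<sigma> z)" "ract z b = lact a z"
  shows "transport z a = b"
  using assms translation_eq[of b z] by (simp add: transport_def isotropy_def)

text \<open>With \<open>a'\<close> and \<open>b'\<close> for the transported elements,
  \<open>(a b) z = a (z b') = (a z) b' = z (a' b')\<close>. Commutation of the two actions keeps the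
  order of the factors, so no anti-homomorphism arises.\<close>

lemma transport_mul:
  assumes "z \<in> topspace Z" "a \<in> isotropy G (\<rho> z)" "b \<in> isotropy G (\<rho> z)"
  shows "transport z (gmul G a b) = gmul H (transport z a) (transport z b)"
proof -
  note a = transport[OF assms(1,2)] and b = transport[OF assms(1,3)]
  show ?thesis
  proof (rule transport_eqI[OF assms(1)])
    show "gmul H (transport z a) (transport z b) \<in> isotropy H (\<sigma> z)"
      using a b by (auto simp: isotropy_def H.arrow_simps)
    have "ract z (gmul H (transport z a) (transport z b)) = ract (lact a z) (transport z b)"
      using a b assms(1) by (simp add: ract_mul isotropy_def)
    also have "\<dots> = lact a (lact b z)"
      using a b assms lact_ract[of a z "transport z b"] by (simp add: isotropy_def)
    also have "\<dots> = lact (gmul G a b) z"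
      using assms by (simp add: lact_mul isotropy_def)
    finally show "ract z (gmul H (transport z a) (transport z b)) = lact (gmul G a b) z" .
  qed
qed

lemma transport_unit:
  assumes "z \<in> topspace Z"
  shows "transport z (\<rho> z) = \<sigma> z"
  using assms sigma_unit[OF assms] left.unit_act[OF assms] right.act_unit[OF assms]
  by (intro transport_eqI) (auto simp: isotropy_def H.arrow_simps)

lemma transport_inv:
  assumes "z \<in> topspace Z" "a \<in> isotropy G (\<rho> z)"
  shows "transport z (ginv G a) = ginv H (transport z a)"
proof (rule transport_eqI[OF assms(1)])
  note a = transport[OF assms]
  show "ginv H (transport z a) \<in> isotropy H (\<sigma> z)"
    using a by (auto simp: isotropy_def H.arrow_simps)
  have "ract (lact (ginv G a) z) (transport z a) = lact (ginv G a) (ract z (transport z a))"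
    using a assms by (intro lact_ract[symmetric]) (auto simp: isotropy_def G.arrow_simps)
  also have "\<dots> = z"
    using a assms by (simp add: lact_inv isotropy_def)
  finally have "ract (lact (ginv G a) z) (transport z a) = z" .
  moreover have "ract (ract (lact (ginv G a) z) (transport z a)) (ginv H (transport z a)) = lact (ginv G a) z"
    using a assms by (intro ract_inv) (auto simp: isotropy_def lact_closed G.arrow_simps)
  ultimately show "ract z (ginv H (transport z a)) = lact (ginv G a) z"
    by simp
qed

text \<open>The arrow \<open>y\<close> is defined by \<open>z y = x w\<close>. With
  \<open>b = transport w a\<close> this gives
  \<open>(x a x^-1) z = x a w y^-1 = x w b y^-1 = z (y b y^-1)\<close>. The same \<open>y\<close>
  serves every \<open>a\<close>.\<close>

lemma transport_conjugate:
  assumes z: "z \<in> topspace Z" "w \<in> topspace Z" and x: "x \<in> arrows G" "grng G x = \<rho> z" "gsrc G x = \<rho> w"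
  obtains y where "y \<in> arrows H" "grng H y = \<sigma> z" "gsrc H y = \<sigma> w"
    and "\<And>a. a \<in> isotropy G (\<rho> w) \<Longrightarrow> transport z (gmul G (gmul G x a) (ginv G x)) =
      gmul H (gmul H y (transport w a)) (ginv H y)"
proof -
  have "lact x w \<in> topspace Z" "\<rho> z = \<rho> (lact x w)"
    using z x by (simp_all add: lact_closed)
  then obtain y where y: "y \<in> arrows H" "grng H y = \<sigma> z" "ract z y = lact x w"
    by (rule ract_transitive[OF z(1)])
  then have src: "gsrc H y = \<sigma> w"
    using ract_closed[of y z] lact_closed[of x w] z x by simp
  show thesis
  proof (rule that[OF y(1,2) src])
    fix a assume a: "a \<in> isotropy G (\<rho> w)"
    note b = transport[OF z(2) a]
    let ?c = "gmul G (gmul G x a) (ginv G x)"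
    have c: "?c \<in> arrows G" "grng G ?c = \<rho> z" "gsrc G ?c = \<rho> z"
      using a x by (auto simp: isotropy_def G.arrow_simps)
    show "transport z ?c = gmul H (gmul H y (transport w a)) (ginv H y)"
    proof (rule transport_eqI[OF z(1)])
      show "gmul H (gmul H y (transport w a)) (ginv H y) \<in> isotropy H (\<sigma> z)"
        using b y src by (auto simp: isotropy_def H.arrow_simps)
      have zw: "z = ract (lact x w) (ginv H y)"
        using y z ract_inv[of y z] by simp
      have "lact ?c z = ract (lact ?c (lact x w)) (ginv H y)"
        by (subst zw, rule lact_ract)
          (use c x y z src lact_closed[of x w] in \<open>auto simp: H.arrow_simps\<close>)
      also have "lact ?c (lact x w) = lact (gmul G x a) (lact (ginv G x) (lact x w))"
        using a x z lact_closed[of x w] by (intro lact_mul) (auto simp: isotropy_def G.arrow_simps)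
      also have "\<dots> = lact x (ract w (transport w a))"
        using a b x z by (simp add: lact_inv lact_mul isotropy_def)
      also have "\<dots> = ract (lact x w) (transport w a)"
        using b x z by (intro lact_ract) (auto simp: isotropy_def)
      also have "\<dots> = ract (ract z y) (transport w a)"
        by (simp add: y)
      also have "\<dots> = ract z (gmul H y (transport w a))"
        using b z y src by (simp add: ract_mul isotropy_def)
      also have "ract \<dots> (ginv H y) = ract z (gmul H (gmul H y (transport w a)) (ginv H y))"
        using b z y src by (intro ract_mul[symmetric]) (auto simp: isotropy_def H.arrow_simps)
      finally show "ract z (gmul H (gmul H y (transport w a)) (ginv H y)) = lact ?c z" by simp
    qed
  qed
qed

text \<open>This is \<open>translation\<close> after \<open>(z, a) \<mapsto> (z, a z)\<close>.
  Properness of the right action enters through \<open>continuous_translation\<close>.\<close>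

lemma continuous_transport:
  "continuous_map (subtopology (prod_topology Z (gtop G)) {(z, a). a \<in> isotropy G (\<rho> z)}) (gtop H)
    (\<lambda>(z, a). transport z a)"
proof -
  let ?T = "subtopology (prod_topology Z (gtop G)) {(z, a). a \<in> isotropy G (\<rho> z)}"
  have "continuous_map ?T (subtopology (prod_topology (gtop G) Z) (left_fibre_product G Z \<rho>)) (\<lambda>(z, a). (a, z))"
    unfolding case_prod_unfold
    by (intro continuous_map_into_subtopology continuous_map_pairedI continuous_map_from_subtopology
        continuous_map_fst continuous_map_snd) (auto simp: left_fibre_product_def isotropy_def)
  from continuous_map_compose[OF this left.continuous_act]
  have "continuous_map ?T Z (\<lambda>(z, a). lact a z)"
    by (simp add: o_def case_prod_unfold)
  then have "continuous_map ?T (prod_topology Z Z) (\<lambda>(z, a). (z, lact a z))"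
    using continuous_map_pairedI[OF continuous_map_from_subtopology[OF continuous_map_fst]]
    by (simp add: case_prod_unfold)
  then have "continuous_map ?T (subtopology (prod_topology Z Z) {(z, w). \<rho> z = \<rho> w}) (\<lambda>(z, a). (z, lact a z))"
    by (rule continuous_map_into_subtopology) (auto simp: isotropy_def lact_closed)
  from continuous_map_compose[OF this continuous_translation]
  show ?thesis
    by (simp add: o_def case_prod_unfold transport_def)
qed

end


section \<open>Closed subgroups along an equivalence\<close>

context topological_groupoid
begin

lemma topspace_subgroup_space: "topspace (subgroup_space G) = closed_subgroups G"
  by (auto simp: subgroup_space_def topspace_fell_topology closed_subgroups_def)

lemma closed_subgroupD:
  assumes "A \<in> closed_subgroups G"
  shows "closedin (gtop G) A" "base_point G A \<in> units G" "isotropy_subgroup G (base_point G A) A"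
  using assms base_point_eq by (auto simp: closed_subgroups_def)

lemma closed_subgroupI:
  assumes "closedin (gtop G) A" "u \<in> units G" "isotropy_subgroup G u A"
  shows "A \<in> closed_subgroups G" "base_point G A = u"
  using assms base_point_eq by (auto simp: closed_subgroups_def)

lemma base_point_eq_rng:
  assumes "A \<in> closed_subgroups G" "a \<in> A"
  shows "base_point G A = grng G a"
  using closed_subgroupD(3)[OF assms(1)] assms(2) by (auto simp: isotropy_subgroup_def isotropy_def)

lemma openin_subgroups_hit:
  assumes "openin (gtop G) U"
  shows "openin (subgroup_space G) {A \<in> closed_subgroups G. A \<inter> U \<noteq> {}}"
proof -
  have "{A \<in> closed_subgroups G. A \<inter> U \<noteq> {}} =
      {F. closedin (gtop G) F \<and> F \<inter> U \<noteq> {}} \<inter> closed_subgroups G"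
    using closed_subgroupD(1) by blast
  then show ?thesis
    using openin_fell_hit[OF assms] unfolding subgroup_space_def openin_subtopology by blast
qed

lemma openin_subgroups_miss:
  assumes "compactin (gtop G) K"
  shows "openin (subgroup_space G) {A \<in> closed_subgroups G. A \<inter> K = {}}"
proof -
  have "{A \<in> closed_subgroups G. A \<inter> K = {}} =
      {F. closedin (gtop G) F \<and> F \<inter> K = {}} \<inter> closed_subgroups G"
    using closed_subgroupD(1) by blast
  then show ?thesis
    using openin_fell_miss[OF assms] unfolding subgroup_space_def openin_subtopology by blast
qed

lemma equiv_orbit_pairs: "equiv (units G) (orbit_pair G ` arrows G)"
proof (rule equivI)
  show "orbit_pair G ` arrows G \<subseteq> units G \<times> units G"
    by (auto simp: orbit_pair_def rng_units src_in)
  show "refl_on (units G) (orbit_pair G ` arrows G)"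
    by (rule refl_onI) (metis image_eqI orbit_pair_def rng_unit src_unit units_arrows)
  show "sym (orbit_pair G ` arrows G)"
  proof (rule symI)
    fix u v assume "(u, v) \<in> orbit_pair G ` arrows G"
    then obtain x where "x \<in> arrows G" "u = grng G x" "v = gsrc G x"
      by (auto simp: orbit_pair_def)
    then show "(v, u) \<in> orbit_pair G ` arrows G"
      by (intro image_eqI[of _ _ "ginv G x"]) (auto simp: orbit_pair_def arrow_simps)
  qed
  show "trans (orbit_pair G ` arrows G)"
  proof (rule transI)
    fix u v w assume "(u, v) \<in> orbit_pair G ` arrows G" "(v, w) \<in> orbit_pair G ` arrows G"
    then obtain x y where "x \<in> arrows G" "y \<in> arrows G" "u = grng G x" "v = gsrc G x" "v = grng G y" "w = gsrc G y"
      by (auto simp: orbit_pair_def)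
    then show "(u, w) \<in> orbit_pair G ` arrows G"
      by (intro image_eqI[of _ _ "gmul G x y"]) (auto simp: orbit_pair_def arrow_simps)
  qed
qed

lemma orbit_space_eq: "orbit_space G = quotient_space (unit_space G) (orbit_pair G ` arrows G)"
  by (simp add: orbit_space_def orbit_pair_def image_def Setcompr_eq_image) 

end

lemma (in lch_open_groupoid) closedin_isotropy:
  assumes "u \<in> units G"
  shows "closedin (gtop G) (isotropy G u)"
proof -
  have u: "closedin (gtop G) {u}"
    using Hausdorff assms units_arrows by (simp add: closedin_Hausdorff_singleton)
  have "continuous_map (gtop G) (gtop G) (grng G)" "continuous_map (gtop G) (gtop G) (gsrc G)"
    using continuous_rng continuous_src by (simp_all add: unit_space_def continuous_map_in_subtopology)
  then have "closedin (gtop G) {x \<in> arrows G. grng G x \<in> {u}}" "closedin (gtop G) {x \<in> arrows G. gsrc G x \<in> {u}}"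
    by (auto intro: closedin_continuous_map_preimage[OF _ u] simp only:)
  moreover have "isotropy G u = {x \<in> arrows G. grng G x \<in> {u}} \<inter> {x \<in> arrows G. gsrc G x \<in> {u}}"
    by (auto simp: isotropy_def)
  ultimately show ?thesis
    by (simp only: closedin_Int)
qed

context lch_groupoid_equivalence
begin

text \<open>The inverse of \<open>transport z\<close>. The opposite actions contain inverses, so
  \<open>a = cotransport z b\<close> is characterised by \<open>a^-1 z = z b^-1\<close>; by
  \<open>transport_inv\<close> this is \<open>a z = z b\<close> again.\<close>

abbreviation "cotransport \<equiv> lch_groupoid_equivalence.transport G lact' \<rho> ract'"

lemma cotransport_transport:
  assumes "z \<in> topspace Z" "a \<in> isotropy G (\<rho> z)"
  shows "cotransport z (transport z a) = a"
proof -
  interpret op: lch_groupoid_equivalence H G Z \<sigma> lact' \<rho> ract' by (rule opposite)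
  show ?thesis
  proof (rule op.transport_eqI[OF assms])
    show "lact (ginv G a) z = ract z (ginv H (transport z a))"
      using transport(2)[OF assms(1) G.inv_isotropy[OF assms(2)]] by (simp add: transport_inv[OF assms])
  qed
qed

lemma transport_cotransport:
  assumes "z \<in> topspace Z" "b \<in> isotropy H (\<sigma> z)"
  shows "cotransport z b \<in> isotropy G (\<rho> z)" "transport z (cotransport z b) = b"
proof -
  interpret op: lch_groupoid_equivalence H G Z \<sigma> lact' \<rho> ract' by (rule opposite)
  let ?a = "cotransport z b"
  show a: "?a \<in> isotropy G (\<rho> z)"
    by (rule op.transport(1)[OF assms])
  have "transport z (ginv G ?a) = ginv H b"
    using op.transport(2)[OF assms] H.inv_isotropy[OF assms(2)] by (intro transport_eqI assms(1)) auto
  then have "ginv H (transport z ?a) = ginv H b"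
    by (simp add: transport_inv[OF assms(1) a])
  then show "transport z ?a = b"
    using H.inv_inv assms(2) transport(1)[OF assms(1) a] unfolding isotropy_def mem_Collect_eq by metis
qed

lemma sigma_surj: "\<sigma> ` topspace Z = units H"
  by (rule lch_groupoid_equivalence.rho_surj[OF opposite])

lemma abelian_isotropy_transfer:
  assumes "abelian_isotropy G"
  shows "abelian_isotropy H"
  unfolding abelian_isotropy_def
proof (intro ballI)
  fix v x y assume v: "v \<in> units H" and xy: "x \<in> isotropy H v" "y \<in> isotropy H v"
  obtain z where z: "z \<in> topspace Z" "v = \<sigma> z"
    using v sigma_surj by blast
  define a b where "a = cotransport z x" and "b = cotransport z y"
  have a: "a \<in> isotropy G (\<rho> z)" "transport z a = x" and b: "b \<in> isotropy G (\<rho> z)" "transport z b = y"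
    using transport_cotransport xy z unfolding a_def b_def by auto
  have "gmul G a b = gmul G b a"
    using assms a b rho_unit[OF z(1)] by (auto simp: abelian_isotropy_def)
  then show "gmul H x y = gmul H y x"
    using transport_mul[OF z(1) a(1) b(1)] transport_mul[OF z(1) b(1) a(1)] a b by simp
qed

lemma transport_closed_subgroup:
  assumes "A \<in> closed_subgroups G" "z \<in> topspace Z" "base_point G A = \<rho> z"
  shows "transport z ` A \<in> closed_subgroups H" "base_point H (transport z ` A) = \<sigma> z"
proof -
  interpret op: lch_groupoid_equivalence H G Z \<sigma> lact' \<rho> ract' by (rule opposite)
  have A: "closedin (gtop G) A" "isotropy_subgroup G (\<rho> z) A"
    using G.closed_subgroupD[OF assms(1)] assms(3) by auto
  then have A_iso: "A \<subseteq> isotropy G (\<rho> z)"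
    by (simp add: isotropy_subgroup_def)
  have v: "\<sigma> z \<in> units H"
    by (rule sigma_unit[OF assms(2)])
  have "isotropy_subgroup H (\<sigma> z) (transport z ` A)"
    unfolding isotropy_subgroup_def
  proof (intro conjI ballI)
    show "transport z ` A \<subseteq> isotropy H (\<sigma> z)"
      using A_iso transport(1)[OF assms(2)] by blast
    show "\<sigma> z \<in> transport z ` A"
      using A(2) transport_unit[OF assms(2)] by (force simp: isotropy_subgroup_def)
  next
    fix x y assume "x \<in> transport z ` A" "y \<in> transport z ` A"
    then obtain a b where "a \<in> A" "b \<in> A" "x = transport z a" "y = transport z b"
      by blast
    then show "gmul H x y \<in> transport z ` A"
      using A(2) A_iso transport_mul[OF assms(2), of a b] by (force simp: isotropy_subgroup_def)
  next
    fix x assume "x \<in> transport z ` A"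
    then obtain a where "a \<in> A" "x = transport z a"
      by blast
    then show "ginv H x \<in> transport z ` A"
      using A(2) A_iso transport_inv[OF assms(2), of a] by (force simp: isotropy_subgroup_def)
  qed
  \<comment> \<open>The image is rewritten as the preimage of \<open>A\<close> under
    \<open>cotransport z\<close>, which is continuous on the isotropy group at
    \<open>\<sigma> z\<close>. That group is closed in \<open>H\<close>, so closedness inside it
    suffices.\<close>
  moreover have "closedin (gtop H) (transport z ` A)"
  proof -
    let ?I = "isotropy H (\<sigma> z)"
    have "continuous_map (subtopology (gtop H) ?I)
        (subtopology (prod_topology Z (gtop H)) {(z, b). b \<in> isotropy H (\<sigma> z)}) (\<lambda>b. (z, b))"
      by (rule continuous_map_into_subtopology)
        (auto intro!: continuous_map_pairedI continuous_map_from_subtopology simp: assms(2))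
    from continuous_map_compose[OF this op.continuous_transport]
    have "continuous_map (subtopology (gtop H) ?I) (gtop G) (cotransport z)"
      by (simp add: o_def)
    from closedin_continuous_map_preimage[OF this A(1)]
    have "closedin (subtopology (gtop H) ?I) {b \<in> topspace (subtopology (gtop H) ?I). cotransport z b \<in> A}" .
    also have "{b \<in> topspace (subtopology (gtop H) ?I). cotransport z b \<in> A} = transport z ` A" (is "?L = ?R")
    proof (intro equalityI subsetI)
      fix b assume "b \<in> ?L"
      then show "b \<in> ?R"
        using transport_cotransport(2)[OF assms(2), of b] by (intro image_eqI[of _ _ "cotransport z b"]) auto
    next
      fix b assume "b \<in> ?R"
      then obtain a where a: "a \<in> A" "b = transport z a" by blast
      then have "a \<in> isotropy G (\<rho> z)" using A_iso by blast
      then show "b \<in> ?L"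
        using a cotransport_transport[OF assms(2)] transport(1)[OF assms(2)] by (auto simp: isotropy_def)
    qed
    finally show ?thesis
      using H.closedin_isotropy[OF v] closedin_trans_full by blast
  qed
  ultimately show "transport z ` A \<in> closed_subgroups H" "base_point H (transport z ` A) = \<sigma> z"
    using v H.closed_subgroupI by auto
qed

text \<open>A witness \<open>a\<close> in \<open>A\<close> with \<open>transport z a\<close> in
  \<open>U\<close> persists: joint continuity gives a box \<open>V1 \<times> V2\<close> around
  \<open>(z, a)\<close>, and a subgroup that hits \<open>V2\<close> and is based at
  \<open>\<rho> z'\<close> with \<open>z'\<close> in \<open>V1\<close> contains a new
  witness.\<close>

lemma openin_transport_hit:
  assumes U: "openin (gtop H) U"
  defines "D \<equiv> {(z, A). base_point G A = \<rho> z}"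
  shows "openin (subtopology (prod_topology Z (subgroup_space G)) D)
    {e \<in> topspace (subtopology (prod_topology Z (subgroup_space G)) D). (\<lambda>(z, A). transport z ` A) e \<inter> U \<noteq> {}}"
    (is "openin ?T ?S")
proof (subst openin_subopen, intro ballI)
  let ?N = "{(z, a). a \<in> isotropy G (\<rho> z)}"
  fix e assume "e \<in> ?S"
  then obtain z A a where e: "e = (z, A)" "z \<in> topspace Z" "A \<in> closed_subgroups G" "base_point G A = \<rho> z"
    and a: "a \<in> A" "transport z a \<in> U"
    by (auto simp: D_def G.topspace_subgroup_space)
  have a_iso: "a \<in> isotropy G (\<rho> z)"
    using G.closed_subgroupD(3)[OF e(3)] e(4) a(1) by (auto simp: isotropy_subgroup_def)
  have "openin (subtopology (prod_topology Z (gtop G)) ?N)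
      {e \<in> topspace (subtopology (prod_topology Z (gtop G)) ?N). (\<lambda>(z, a). transport z a) e \<in> U}"
    by (rule openin_continuous_map_preimage[OF continuous_transport U])
  \<comment> \<open>Transport is continuous on the isotropy pairs \<open>?N\<close> alone. Extending
    the preimage to an open set \<open>W\<close> of the whole product allows a box to be
    chosen.\<close>
  then obtain W where W: "openin (prod_topology Z (gtop G)) W"
    and W_eq: "{e \<in> topspace (subtopology (prod_topology Z (gtop G)) ?N). (\<lambda>(z, a). transport z a) e \<in> U} = W \<inter> ?N"
    unfolding openin_subtopology by blast
  have "(z, a) \<in> W"
    using W_eq e(2) a(2) a_iso by (auto simp: isotropy_def set_eq_iff)
  then obtain V1 V2 where V: "openin Z V1" "openin (gtop G) V2" "z \<in> V1" "a \<in> V2" "V1 \<times> V2 \<subseteq> W"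
    using W unfolding openin_prod_topology_alt by metis
  let ?O = "(V1 \<times> {A \<in> closed_subgroups G. A \<inter> V2 \<noteq> {}}) \<inter> D"
  have "openin (prod_topology Z (subgroup_space G)) (V1 \<times> {A \<in> closed_subgroups G. A \<inter> V2 \<noteq> {}})"
    using V G.openin_subgroups_hit by (simp add: openin_prod_Times_iff)
  then have "openin ?T ?O"
    unfolding openin_subtopology by blast
  moreover have "e \<in> ?O"
    using e a V by (auto simp: D_def)
  moreover have "?O \<subseteq> ?S"
  proof
    fix e' assume "e' \<in> ?O"
    then obtain z' A' a' where e': "e' = (z', A')" "z' \<in> V1" "A' \<in> closed_subgroups G"
      "base_point G A' = \<rho> z'" "a' \<in> A'" "a' \<in> V2"
      by (auto simp: D_def)
    have "a' \<in> isotropy G (\<rho> z')"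
      using G.closed_subgroupD(3)[OF e'(3)] e'(4,5) by (auto simp: isotropy_subgroup_def)
    then have "(z', a') \<in> W \<inter> ?N"
      using V(5) e' by blast
    then have "transport z' a' \<in> U"
      using W_eq by (auto simp: set_eq_iff)
    moreover have "z' \<in> topspace Z"
      using V(1) e'(2) openin_subset by blast
    ultimately show "e' \<in> ?S"
      using e' by (auto simp: D_def G.topspace_subgroup_space)
  qed
  ultimately show "\<exists>T. openin ?T T \<and> e \<in> T \<and> T \<subseteq> ?S"
    by blast
qed

text \<open>If \<open>z\<close> is in \<open>C\<close> and \<open>b = transport z a\<close> is in
  \<open>K\<close>, then \<open>a z = z b\<close> lies in the compact set \<open>?CK\<close> of
  products. Properness of the left action then places \<open>(z, a)\<close> in a compact set, and it
  remains to see that these pairs form a closed set.\<close>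

lemma compactin_transport_preimage:
  assumes C: "compactin Z C" and K: "compactin (gtop H) K"
  shows "compactin (prod_topology Z (gtop G)) {(z, a). z \<in> C \<and> a \<in> isotropy G (\<rho> z) \<and> transport z a \<in> K}"
    (is "compactin _ ?L")
proof -
  have C_sub: "C \<subseteq> topspace Z" and K_sub: "K \<subseteq> arrows H"
    using C K compactin_subset_topspace by auto
  have rho: "continuous_map Z (gtop G) \<rho>" and sigma: "continuous_map Z (gtop H) \<sigma>"
    using left.continuous_moment right.continuous_moment
    by (simp_all add: unit_space_def continuous_map_in_subtopology)
  have rngG: "continuous_map (gtop G) (gtop G) (grng G)" and srcG: "continuous_map (gtop G) (gtop G) (gsrc G)"
    and rngH: "continuous_map (gtop H) (gtop H) (grng H)"
    using G.continuous_rng G.continuous_src H.continuous_rng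
    by (simp_all add: unit_space_def continuous_map_in_subtopology)
  let ?R = "right_fibre_product H Z \<sigma>" and ?N = "{(z, a). a \<in> isotropy G (\<rho> z)}"
  \<comment> \<open>The product \<open>z y\<close> is defined for matching pairs. Matching is a
    closed condition since \<open>H\<close> is Hausdorff, so the matching pairs in
    \<open>C \<times> K\<close> form a compact set.\<close>
  have "closedin (prod_topology Z (gtop H))
      {e \<in> topspace (prod_topology Z (gtop H)). (\<sigma> \<circ> fst) e = (grng H \<circ> snd) e}"
    by (intro closedin_continuous_maps_eq[OF H.Hausdorff] continuous_map_compose[OF continuous_map_fst sigma]
        continuous_map_compose[OF continuous_map_snd rngH])
  also have "{e \<in> topspace (prod_topology Z (gtop H)). (\<sigma> \<circ> fst) e = (grng H \<circ> snd) e} = ?R"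
    by (auto simp: right_fibre_product_def)
  finally have "compactin (prod_topology Z (gtop H)) (?R \<inter> C \<times> K)"
    using C K by (intro closed_Int_compactin) (auto simp: compactin_Times)
  then have "compactin (subtopology (prod_topology Z (gtop H)) ?R) (?R \<inter> C \<times> K)"
    by (simp add: compactin_subtopology)
  from image_compactin[OF this right.continuous_act]
  have "compactin Z ((\<lambda>(z, y). ract z y) ` (?R \<inter> C \<times> K))" (is "compactin Z ?CK") .
  then have "compactin (prod_topology Z Z) (?CK \<times> C)"
    using C by (simp add: compactin_Times)
  from left.proper[OF this]
  have "compactin (prod_topology (gtop G) Z) {(x, z) \<in> left_fibre_product G Z \<rho>. (lact x z, z) \<in> ?CK \<times> C}"
    by (simp add: compactin_subtopology)
  from image_compactin[OF this continuous_map_pairedI[OF continuous_map_snd continuous_map_fst]]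
  have "compactin (prod_topology Z (gtop G))
    ((\<lambda>e. (snd e, fst e)) ` {(x, z) \<in> left_fibre_product G Z \<rho>. (lact x z, z) \<in> ?CK \<times> C})"
    (is "compactin _ ?M") .
  moreover have "?L \<subseteq> ?M"
  proof
    fix e assume "e \<in> ?L"
    then obtain z a where e: "e = (z, a)" "z \<in> C" "a \<in> isotropy G (\<rho> z)" "transport z a \<in> K"
      by blast
    then have z: "z \<in> topspace Z"
      using C_sub by blast
    have "(z, transport z a) \<in> ?R \<inter> C \<times> K"
      using e z transport(1)[OF z e(3)] by (auto simp: right_fibre_product_def isotropy_def)
    then have "lact a z \<in> ?CK"
      using transport(2)[OF z e(3)] by force
    then show "e \<in> ?M"
      using e z by (intro image_eqI[of _ _ "(a, z)"]) (auto simp: left_fibre_product_def isotropy_def)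
  qed
  \<comment> \<open>The isotropy pairs form a closed set because \<open>G\<close> is Hausdorff, and
    \<open>K\<close> is closed because \<open>H\<close> is. Continuity of transport on that closed
    set then gives a set closed in the product.\<close>
  moreover have "closedin (prod_topology Z (gtop G)) ?L"
  proof -
    let ?P = "prod_topology Z (gtop G)"
    have "closedin ?P {e \<in> topspace ?P. (grng G \<circ> snd) e = (\<rho> \<circ> fst) e}"
      "closedin ?P {e \<in> topspace ?P. (gsrc G \<circ> snd) e = (\<rho> \<circ> fst) e}"
      by (intro closedin_continuous_maps_eq[OF G.Hausdorff] continuous_map_compose[OF continuous_map_fst rho]
          continuous_map_compose[OF continuous_map_snd rngG] continuous_map_compose[OF continuous_map_snd srcG])+
    then have "closedin ?P ({e \<in> topspace ?P. (grng G \<circ> snd) e = (\<rho> \<circ> fst) e} \<inter>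
        {e \<in> topspace ?P. (gsrc G \<circ> snd) e = (\<rho> \<circ> fst) e})"
      by (rule closedin_Int)
    also have "{e \<in> topspace ?P. (grng G \<circ> snd) e = (\<rho> \<circ> fst) e} \<inter>
        {e \<in> topspace ?P. (gsrc G \<circ> snd) e = (\<rho> \<circ> fst) e} = topspace ?P \<inter> ?N"
      by (auto simp: isotropy_def)
    finally have N: "closedin ?P (topspace ?P \<inter> ?N)" .
    have "closedin (gtop H) K"
      using K H.Hausdorff compactin_imp_closedin by blast
    from closedin_continuous_map_preimage[OF continuous_transport this]
    have "closedin (subtopology ?P (topspace ?P \<inter> ?N))
        {e \<in> topspace (subtopology ?P ?N). (\<lambda>(z, a). transport z a) e \<in> K}"
      by (metis subtopology_restrict)
    then have "closedin ?P {e \<in> topspace (subtopology ?P ?N). (\<lambda>(z, a). transport z a) e \<in> K}"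
      using N closedin_trans_full by blast
    moreover have "closedin ?P (C \<times> arrows G)"
      using compactin_imp_closedin[OF Hausdorff C] by (simp add: closedin_prod_Times_iff)
    ultimately have "closedin ?P ({e \<in> topspace (subtopology ?P ?N). (\<lambda>(z, a). transport z a) e \<in> K} \<inter> C \<times> arrows G)"
      by (rule closedin_Int)
    also have "{e \<in> topspace (subtopology ?P ?N). (\<lambda>(z, a). transport z a) e \<in> K} \<inter> C \<times> arrows G = ?L"
      using C_sub by (auto simp: isotropy_def)
    finally show ?thesis .
  qed
  ultimately show ?thesis
    by (meson closed_compactin)
qed

text \<open>A tube argument. Over a compact neighbourhood \<open>C\<close> of \<open>z\<close> the
  offending pairs form a compact set \<open>L\<close>, whose slice over \<open>z\<close> avoids
  \<open>A\<close> and so lies in an open \<open>V\<close> inside a compact \<open>M\<close>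
  disjoint from \<open>A\<close>. The points over which \<open>L\<close> leaves \<open>V\<close>
  form a compact, hence closed, set \<open>?Q\<close> without \<open>z\<close>. Off
  \<open>?Q\<close>, inside \<open>C0\<close>, a subgroup missing \<open>M\<close> contains no
  offending element.\<close>

lemma openin_transport_miss:
  assumes K: "compactin (gtop H) K"
  defines "D \<equiv> {(z, A). base_point G A = \<rho> z}"
  shows "openin (subtopology (prod_topology Z (subgroup_space G)) D)
    {e \<in> topspace (subtopology (prod_topology Z (subgroup_space G)) D). (\<lambda>(z, A). transport z ` A) e \<inter> K = {}}"
    (is "openin ?T ?S")
proof (subst openin_subopen, intro ballI)
  fix e assume "e \<in> ?S"
  then obtain z A where e: "e = (z, A)" "z \<in> topspace Z" "A \<in> closed_subgroups G" "base_point G A = \<rho> z"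
    and miss: "transport z ` A \<inter> K = {}"
    by (auto simp: D_def G.topspace_subgroup_space)
  obtain C0 C where C: "openin Z C0" "compactin Z C" "z \<in> C0" "C0 \<subseteq> C"
    using locally_compact e(2) unfolding locally_compact_space_def by metis
  define L where "L = {(z, a). z \<in> C \<and> a \<in> isotropy G (\<rho> z) \<and> transport z a \<in> K}"
  have L: "compactin (prod_topology Z (gtop G)) L"
    unfolding L_def by (rule compactin_transport_preimage[OF C(2) K])
  \<comment> \<open>The complement of \<open>A\<close> is open, hence locally compact. Choosing the
    compact neighbourhood of the slice inside it makes \<open>M\<close> disjoint from
    \<open>A\<close>.\<close>
  define Y where "Y = subtopology (gtop G) (arrows G - A)"
  have A: "closedin (gtop G) A" "A \<subseteq> arrows G"
    using G.closed_subgroupD(1)[OF e(3)] closedin_subset by auto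
  then have open_Y: "openin (gtop G) (arrows G - A)"
    by blast
  have "closedin (prod_topology Z (gtop G)) ({z} \<times> arrows G)"
    using Hausdorff e(2) by (simp add: closedin_prod_Times_iff closedin_Hausdorff_singleton)
  then have "compactin (prod_topology Z (gtop G)) (({z} \<times> arrows G) \<inter> L)"
    using L by (rule closed_Int_compactin)
  from image_compactin[OF this continuous_map_snd]
  have "compactin (gtop G) (snd ` (({z} \<times> arrows G) \<inter> L))" (is "compactin _ ?Lz") .
  moreover have "?Lz \<inter> A = {}"
    using miss by (auto simp: L_def)
  ultimately have "compactin Y ?Lz"
    by (auto simp: Y_def compactin_subtopology)
  moreover have "locally_compact_space Y" "Hausdorff_space Y"
    unfolding Y_def using G.locally_compact G.Hausdorff open_Y
    by (auto intro: locally_compact_space_open_subset Hausdorff_space_subtopology)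
  ultimately obtain V M where V: "openin Y V" "compactin Y M" "?Lz \<subseteq> V" "V \<subseteq> M"
    using locally_compact_space_compact_closed_compact[of Y] by metis
  have V_open: "openin (gtop G) V"
    using V(1) open_Y by (simp add: Y_def openin_open_subtopology)
  have M: "compactin (gtop G) M" "M \<inter> A = {}"
    using V(2) by (auto simp: Y_def compactin_subtopology)
  have "closedin (prod_topology Z (gtop G)) (topspace Z \<times> (arrows G - V))"
    using V_open by (simp add: closedin_prod_Times_iff closedin_diff)
  then have "compactin (prod_topology Z (gtop G)) ((topspace Z \<times> (arrows G - V)) \<inter> L)"
    using L by (rule closed_Int_compactin)
  from image_compactin[OF this continuous_map_fst]
  have "closedin Z (fst ` ((topspace Z \<times> (arrows G - V)) \<inter> L))" (is "closedin Z ?Q")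
    using Hausdorff compactin_imp_closedin by blast
  then have W: "openin Z (C0 - ?Q)"
    using C(1) by (rule openin_diff[rotated])
  let ?O = "((C0 - ?Q) \<times> {A \<in> closed_subgroups G. A \<inter> M = {}}) \<inter> D"
  have "openin (prod_topology Z (subgroup_space G)) ((C0 - ?Q) \<times> {A \<in> closed_subgroups G. A \<inter> M = {}})"
    using W G.openin_subgroups_miss[OF M(1)] by (simp add: openin_prod_Times_iff)
  then have "openin ?T ?O"
    unfolding openin_subtopology by blast
  moreover have "z \<notin> ?Q"
  proof
    assume "z \<in> ?Q"
    then obtain a where "(z, a) \<in> L" "a \<in> arrows G" "a \<notin> V"
      by auto
    then show False
      using V(3) by force
  qed
  then have "e \<in> ?O"
    using e C(3) M(2) by (auto simp: D_def)
  moreover have "?O \<subseteq> ?S"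
  proof
    fix e' assume "e' \<in> ?O"
    then obtain z' A' where e': "e' = (z', A')" "z' \<in> C0" "z' \<notin> ?Q" "A' \<in> closed_subgroups G"
      "base_point G A' = \<rho> z'" "A' \<inter> M = {}"
      by (auto simp: D_def)
    have z': "z' \<in> topspace Z"
      using C(1) e'(2) openin_subset by blast
    have "transport z' a \<notin> K" if "a \<in> A'" for a
    proof
      assume "transport z' a \<in> K"
      moreover have a: "a \<in> isotropy G (\<rho> z')"
        using G.closed_subgroupD(3)[OF e'(4)] e'(5) that by (auto simp: isotropy_subgroup_def)
      ultimately have "(z', a) \<in> L"
        using e'(2) C(4) by (auto simp: L_def)
      moreover have "a \<notin> V"
        using that e'(6) V(4) by blast
      ultimately have "z' \<in> ?Q"
        using z' a by (intro image_eqI[of _ _ "(z', a)"]) (auto simp: isotropy_def)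
      then show False
        using e'(3) by blast
    qed
    then show "e' \<in> ?S"
      using e' z' by (auto simp: D_def G.topspace_subgroup_space)
  qed
  ultimately show "\<exists>T. openin ?T T \<and> e \<in> T \<and> T \<subseteq> ?S"
    by blast
qed

lemma continuous_transport_subgroups:
  "continuous_map (subtopology (prod_topology Z (subgroup_space G)) {(z, A). base_point G A = \<rho> z})
    (subgroup_space H) (\<lambda>(z, A). transport z ` A)"
  unfolding subgroup_space_def[of H]
proof (rule continuous_map_into_subtopology)
  let ?T = "subtopology (prod_topology Z (subgroup_space G)) {(z, A). base_point G A = \<rho> z}"
  have sub: "(\<lambda>(z, A). transport z ` A) e \<in> closed_subgroups H" if "e \<in> topspace ?T" for e
    using that transport_closed_subgroup(1) by (auto simp: G.topspace_subgroup_space)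
  then show "(\<lambda>(z, A). transport z ` A) \<in> topspace ?T \<rightarrow> closed_subgroups H"
    by blast
  show "continuous_map ?T (fell_topology (gtop H)) (\<lambda>(z, A). transport z ` A)"
    using sub H.closed_subgroupD(1) openin_transport_miss openin_transport_hit
    by (intro continuous_map_into_fell) auto
qed


subsection \<open>Transfer of properness modulo isotropy\<close>

lemma orbit_pair_imp:
  assumes "z \<in> topspace Z" "w \<in> topspace Z" "(\<rho> z, \<rho> w) \<in> orbit_pair G ` arrows G"
  shows "(\<sigma> z, \<sigma> w) \<in> orbit_pair H ` arrows H"
proof -
  obtain x where x: "x \<in> arrows G" "grng G x = \<rho> z" "gsrc G x = \<rho> w"
    using assms(3) by (auto simp: orbit_pair_def)
  obtain y where "y \<in> arrows H" "grng H y = \<sigma> z" "gsrc H y = \<sigma> w"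
    by (rule transport_conjugate[OF assms(1,2) x])
  then show ?thesis
    by (intro image_eqI[of _ _ y]) (auto simp: orbit_pair_def)
qed

lemma orbit_pair_iff:
  assumes "z \<in> topspace Z" "w \<in> topspace Z"
  shows "(\<rho> z, \<rho> w) \<in> orbit_pair G ` arrows G \<longleftrightarrow> (\<sigma> z, \<sigma> w) \<in> orbit_pair H ` arrows H"
  using orbit_pair_imp[OF assms] lch_groupoid_equivalence.orbit_pair_imp[OF opposite assms] by blast

text \<open>Separating open sets are carried from one orbit space to the other by pulling back along
  the continuous \<open>\<rho>\<close> and pushing forward along the open \<open>\<sigma>\<close>.
  Disjointness survives because the orbits correspond bijectively.\<close>

lemma Hausdorff_orbit_space_transfer:
  assumes "Hausdorff_space (orbit_space G)"
  shows "Hausdorff_space (orbit_space H)"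
proof -
  let ?EG = "orbit_pair G ` arrows G" and ?EH = "orbit_pair H ` arrows H"
  note open_iff = G.orbit_space_eq H.orbit_space_eq openin_quotient_space G.topspace_unit_space
    H.topspace_unit_space
  have class_iff: "?EG `` {\<rho> z} = ?EG `` {\<rho> w} \<longleftrightarrow> ?EH `` {\<sigma> z} = ?EH `` {\<sigma> w}"
    if "z \<in> topspace Z" "w \<in> topspace Z" for z w
    using that orbit_pair_iff eq_equiv_class_iff[OF G.equiv_orbit_pairs] eq_equiv_class_iff[OF H.equiv_orbit_pairs]
      rho_unit sigma_unit by metis
  \<comment> \<open>The image of \<open>\<U>\<close> under the bijection that sends the orbit of
    \<open>\<rho> z\<close> to the orbit of \<open>\<sigma> z\<close>; \<open>class_iff\<close> says
    that this does not depend on \<open>z\<close>.\<close>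
  define push where "push = (\<lambda>\<U>. {?EH `` {\<sigma> z} | z. z \<in> topspace Z \<and> ?EG `` {\<rho> z} \<in> \<U>})"
  have push_iff: "?EH `` {\<sigma> z} \<in> push \<U> \<longleftrightarrow> ?EG `` {\<rho> z} \<in> \<U>" if "z \<in> topspace Z" for z \<U>
  proof
    assume "?EH `` {\<sigma> z} \<in> push \<U>"
    then obtain w where "w \<in> topspace Z" "?EH `` {\<sigma> z} = ?EH `` {\<sigma> w}" "?EG `` {\<rho> w} \<in> \<U>"
      by (auto simp: push_def)
    then show "?EG `` {\<rho> z} \<in> \<U>"
      using class_iff[OF that \<open>w \<in> topspace Z\<close>] by simp
  next
    assume "?EG `` {\<rho> z} \<in> \<U>"
    then show "?EH `` {\<sigma> z} \<in> push \<U>"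
      using that unfolding push_def by blast
  qed
  have open_push: "openin (orbit_space H) (push \<U>)" if "openin (orbit_space G) \<U>" for \<U>
    unfolding open_iff
  proof
    show "push \<U> \<subseteq> units H // ?EH"
      using sigma_unit by (auto simp: push_def quotient_def)
    have "openin (unit_space G) {u \<in> units G. ?EG `` {u} \<in> \<U>}"
      using that by (simp add: open_iff)
    from openin_continuous_map_preimage[OF left.continuous_moment this]
    have "openin Z {z \<in> topspace Z. \<rho> z \<in> {u \<in> units G. ?EG `` {u} \<in> \<U>}}" .
    with open_src_moment
    have "openin (unit_space H) (\<sigma> ` {z \<in> topspace Z. \<rho> z \<in> {u \<in> units G. ?EG `` {u} \<in> \<U>}})"
      unfolding open_map_def by blast
    also have "\<sigma> ` {z \<in> topspace Z. \<rho> z \<in> {u \<in> units G. ?EG `` {u} \<in> \<U>}} =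
        {v \<in> units H. ?EH `` {v} \<in> push \<U>}"
      unfolding sigma_surj[symmetric] using push_iff rho_unit by auto
    finally show "openin (unit_space H) {v \<in> units H. ?EH `` {v} \<in> push \<U>}" .
  qed
  have "topspace (orbit_space H) = (\<lambda>v. ?EH `` {v}) ` units H"
    by (auto simp: H.orbit_space_eq topspace_quotient_space H.topspace_unit_space quotient_def)
  then have top: "topspace (orbit_space H) = (\<lambda>z. ?EH `` {\<sigma> z}) ` topspace Z"
    by (simp only: sigma_surj[symmetric] image_image)
  show ?thesis
    unfolding Hausdorff_space_def
  proof (intro allI impI)
    fix c d assume cd: "c \<in> topspace (orbit_space H) \<and> d \<in> topspace (orbit_space H) \<and> c \<noteq> d"
    then obtain z w where z: "z \<in> topspace Z" "c = ?EH `` {\<sigma> z}" and w: "w \<in> topspace Z" "d = ?EH `` {\<sigma> w}"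
      unfolding top by blast
    have "?EG `` {\<rho> z} \<noteq> ?EG `` {\<rho> w}"
      using cd z w class_iff by blast
    moreover have "?EG `` {\<rho> z} \<in> topspace (orbit_space G)" "?EG `` {\<rho> w} \<in> topspace (orbit_space G)"
      using rho_unit[OF z(1)] rho_unit[OF w(1)]
      by (auto simp: G.orbit_space_eq topspace_quotient_space G.topspace_unit_space quotient_def)
    ultimately obtain \<U> \<V> where UV: "openin (orbit_space G) \<U>" "openin (orbit_space G) \<V>"
        "?EG `` {\<rho> z} \<in> \<U>" "?EG `` {\<rho> w} \<in> \<V>" "disjnt \<U> \<V>"
      using assms unfolding Hausdorff_space_def by metis
    have "disjnt (push \<U>) (push \<V>)"
      unfolding disjnt_iff
    proof (intro allI notI)
      fix e assume e: "e \<in> push \<U> \<and> e \<in> push \<V>"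
      then obtain t where t: "t \<in> topspace Z" "e = ?EH `` {\<sigma> t}"
        unfolding push_def by blast
      then have "?EG `` {\<rho> t} \<in> \<U>" "?EG `` {\<rho> t} \<in> \<V>"
        using e push_iff[OF t(1)] by simp_all
      then show False
        using UV(5) unfolding disjnt_iff by blast
    qed
    then show "\<exists>U V. openin (orbit_space H) U \<and> openin (orbit_space H) V \<and> c \<in> U \<and> d \<in> V \<and> disjnt U V"
      using open_push[OF UV(1)] open_push[OF UV(2)] UV(3,4) push_iff[OF z(1)] push_iff[OF w(1)] z(2) w(2)
      by metis
  qed
qed

text \<open>By \<open>transport_conjugate\<close>, conjugation by an arrow \<open>x\<close> of
  \<open>G\<close> corresponds to conjugation by some \<open>y\<close> of \<open>H\<close>. Abelian
  isotropy on both sides lets these particular arrows compute the two actions.\<close>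

lemma orbit_relation_act_transport:
  assumes ab: "abelian_isotropy G" and zw: "z \<in> topspace Z" "w \<in> topspace Z"
    and orb: "(\<rho> z, \<rho> w) \<in> orbit_pair G ` arrows G" and A: "A \<subseteq> isotropy G (\<rho> w)"
  shows "orbit_relation_act H (\<sigma> z, \<sigma> w) (transport w ` A) =
      transport z ` orbit_relation_act G (\<rho> z, \<rho> w) A"
proof -
  obtain x where x: "x \<in> arrows G" "grng G x = \<rho> z" "gsrc G x = \<rho> w"
    using orb by (auto simp: orbit_pair_def)
  obtain y where y: "y \<in> arrows H" "grng H y = \<sigma> z" "gsrc H y = \<sigma> w"
    and conj: "\<And>a. a \<in> isotropy G (\<rho> w) \<Longrightarrow> transport z (gmul G (gmul G x a) (ginv G x)) =
      gmul H (gmul H y (transport w a)) (ginv H y)"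
    by (rule transport_conjugate[OF zw x]) (rule that; simp)
  have "transport w ` A \<subseteq> isotropy H (gsrc H y)"
    using A transport(1)[OF zw(2)] y(3) by auto
  from H.orbit_relation_act_eq[OF abelian_isotropy_transfer[OF ab] y(1) this]
  have "orbit_relation_act H (\<sigma> z, \<sigma> w) (transport w ` A) = conjugate H y (transport w ` A)"
    using y by (simp add: orbit_pair_def)
  also have "\<dots> = transport z ` conjugate G x A"
    unfolding conjugate_def image_image using A conj by (intro image_cong) auto
  also have "conjugate G x A = orbit_relation_act G (\<rho> z, \<rho> w) A"
    using G.orbit_relation_act_eq[OF ab x(1), of A] A x by (simp add: orbit_pair_def)
  finally show ?thesis .
qed

text \<open>On triples \<open>(z, w, B)\<close> with \<open>B\<close> based at
  \<open>\<sigma> w\<close>, the action factors in three stages: \<open>pull\<close> carries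
  \<open>B\<close> to base point \<open>\<rho> w\<close>, the orbit relation of \<open>G\<close>
  moves it to \<open>\<rho> z\<close>, and \<open>transport z\<close> carries it to
  \<open>\<sigma> z\<close>. No stage requires a continuous choice of arrow.\<close>

lemma orbit_relation_acts_continuously_transfer:
  assumes ab: "abelian_isotropy G" and acts: "orbit_relation_acts_continuously G"
  shows "orbit_relation_acts_continuously H"
proof -
  interpret op: lch_groupoid_equivalence H G Z \<sigma> lact' \<rho> ract' by (rule opposite)
  define RG RH where "RG = orbit_pair G ` arrows G" and "RH = orbit_pair H ` arrows H"
  define P where "P = prod_topology (prod_topology Z Z) (subgroup_space H)"
  define D where "D = {(zw, B). (\<sigma> (fst zw), \<sigma> (snd zw)) \<in> RH \<and> \<sigma> (snd zw) = base_point H B}"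
  define EH where "EH = subtopology (prod_topology (orbit_relation_space H) (subgroup_space H)) {(e, B). snd e = base_point H B}"
  define EG where "EG = subtopology (prod_topology (orbit_relation_space G) (subgroup_space G)) {(e, B). snd e = base_point G B}"
  define q where "q = map_prod (map_prod \<sigma> \<sigma>) (id :: 'h set \<Rightarrow> 'h set)"
  define pull where "pull = (\<lambda>e::('z \<times> 'z) \<times> 'h set. cotransport (snd (fst e)) ` snd e)"
  define move where "move = (\<lambda>e::('z \<times> 'z) \<times> 'h set.
    orbit_relation_act G (\<rho> (fst (fst e)), \<rho> (snd (fst e))) (pull e))"
  have top_D: "z \<in> topspace Z \<and> w \<in> topspace Z \<and> B \<in> closed_subgroups H \<and> (\<sigma> z, \<sigma> w) \<in> RH
      \<and> base_point H B = \<sigma> w" if "((z, w), B) \<in> topspace (subtopology P D)" for z w B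
    using that by (auto simp: P_def D_def H.topspace_subgroup_space)
  \<comment> \<open>The nested subspaces are flattened into one subspace of a product, so that
    \<open>q\<close> becomes the restriction of a product map.\<close>
  have EH_eq: "EH = subtopology (prod_topology (prod_topology (unit_space H) (unit_space H)) (subgroup_space H))
      {(e, B). e \<in> RH \<and> snd e = base_point H B}"
    unfolding EH_def orbit_relation_space_def RH_def[symmetric] prod_topology_subtopology subtopology_subtopology
    by (rule subtopology_cong_Int) auto
  have quot: "quotient_map (subtopology P D) EH q"
  proof (rule continuous_open_imp_quotient_map)
    have q_iff: "q e \<in> {(e, B). e \<in> RH \<and> snd e = base_point H B} \<longleftrightarrow> e \<in> D" for e
      unfolding q_def D_def
      by (cases e; cases "fst e") (simp only: map_prod_simp id_apply mem_Collect_eq prod.case fst_conv snd_conv)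
    \<comment> \<open>\<open>D\<close> is the full preimage of the domain of the action of
      \<open>H\<close>. An open map restricted to a full preimage stays open onto the corresponding
      subspace.\<close>
    from q_iff have D_eq: "{e \<in> topspace P. q e \<in> {(e, B). e \<in> RH \<and> snd e = base_point H B}} = topspace P \<inter> D"
      by (simp only: Collect_conj_eq Collect_mem_eq)
    have "open_map P (prod_topology (prod_topology (unit_space H) (unit_space H)) (subgroup_space H)) q"
      unfolding P_def q_def by (intro open_map_map_prod open_src_moment) (simp add: open_map_def)
    from open_map_restriction[OF this D_eq]
    show "open_map (subtopology P D) EH q"
      by (metis EH_eq subtopology_restrict)
    have "continuous_map P (prod_topology (prod_topology (unit_space H) (unit_space H)) (subgroup_space H)) q"
      unfolding P_def q_def map_prod_def case_prod_unfold
      by (intro continuous_map_pairedI continuous_map_compose[OF _ right.continuous_moment, unfolded o_def])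
        (auto intro: continuous_map_compose[OF continuous_map_fst continuous_map_fst, unfolded o_def]
          continuous_map_compose[OF continuous_map_fst continuous_map_snd, unfolded o_def] continuous_map_snd)
    then show cont_q: "continuous_map (subtopology P D) EH q"
      unfolding EH_eq
      by (intro continuous_map_into_subtopology continuous_map_from_subtopology funcsetI)
        (simp_all only: q_iff topspace_subtopology Int_iff)
    show "q ` topspace (subtopology P D) = topspace EH"
    proof (intro equalityI subsetI)
      fix e assume "e \<in> q ` topspace (subtopology P D)"
      then show "e \<in> topspace EH"
        using continuous_map_image_subset_topspace[OF cont_q] by blast
    next
      fix e assume "e \<in> topspace EH"
      then obtain u v B where e: "e = ((u, v), B)" "u \<in> units H" "v \<in> units H" "B \<in> closed_subgroups H"
        "(u, v) \<in> RH" "base_point H B = v"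
        by (auto simp: EH_eq H.topspace_unit_space H.topspace_subgroup_space)
      then obtain z w where "z \<in> topspace Z" "w \<in> topspace Z" "u = \<sigma> z" "v = \<sigma> w"
        using sigma_surj by (metis imageE)
      then show "e \<in> q ` topspace (subtopology P D)"
        using e by (intro image_eqI[of _ _ "((z, w), B)"]) (auto simp: q_def P_def D_def H.topspace_subgroup_space)
    qed
  qed
  have cont_z: "continuous_map (subtopology P D) Z (\<lambda>e. fst (fst e))"
    and cont_w: "continuous_map (subtopology P D) Z (\<lambda>e. snd (fst e))"
    and cont_B: "continuous_map (subtopology P D) (subgroup_space H) snd"
    unfolding P_def
    by (auto intro!: continuous_map_from_subtopology continuous_map_snd
        intro: continuous_map_compose[OF continuous_map_fst continuous_map_fst, unfolded o_def]
          continuous_map_compose[OF continuous_map_fst continuous_map_snd, unfolded o_def])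
  have "continuous_map (subtopology P D)
      (subtopology (prod_topology Z (subgroup_space H)) {(z, B). base_point H B = \<sigma> z}) (\<lambda>e. (snd (fst e), snd e))"
    using top_D by (intro continuous_map_into_subtopology continuous_map_pairedI cont_w cont_B) auto
  from continuous_map_compose[OF this op.continuous_transport_subgroups]
  have cont_pull: "continuous_map (subtopology P D) (subgroup_space G) pull"
    by (simp add: o_def pull_def)
  have pull: "pull e \<in> closed_subgroups G" "base_point G (pull e) = \<rho> (snd (fst e))"
    if "e \<in> topspace (subtopology P D)" for e
    using that op.transport_closed_subgroup[of "snd e" "snd (fst e)"] top_D by (cases e; auto simp: pull_def)+
  have RG: "(\<rho> (fst (fst e)), \<rho> (snd (fst e))) \<in> RG" if "e \<in> topspace (subtopology P D)" for e
    using that top_D[of "fst (fst e)" "snd (fst e)" "snd e"] orbit_pair_iff unfolding RG_def RH_def by simp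
  have "continuous_map (subtopology P D) EG (\<lambda>e. ((\<rho> (fst (fst e)), \<rho> (snd (fst e))), pull e))"
    unfolding EG_def orbit_relation_space_def RG_def[symmetric]
    using RG pull
    by (intro continuous_map_into_subtopology continuous_map_pairedI cont_pull
        continuous_map_compose[OF cont_z left.continuous_moment, unfolded o_def]
        continuous_map_compose[OF cont_w left.continuous_moment, unfolded o_def]) auto
  moreover have "continuous_map EG (subgroup_space G) (\<lambda>(e, A). orbit_relation_act G e A)"
    using acts by (simp add: EG_def orbit_relation_acts_continuously_def)
  ultimately have "continuous_map (subtopology P D) (subgroup_space G)
      ((\<lambda>(e, A). orbit_relation_act G e A) \<circ> (\<lambda>e. ((\<rho> (fst (fst e)), \<rho> (snd (fst e))), pull e)))"
    by (rule continuous_map_compose)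
  then have cont_move: "continuous_map (subtopology P D) (subgroup_space G) move"
    by (simp add: o_def move_def)
  \<comment> \<open>\<open>transport z\<close> is controlled on subgroups based at
    \<open>\<rho> z\<close>. Conjugation by \<open>x\<close> moves the base point from the source
    \<open>\<rho> w\<close> to the range \<open>\<rho> z\<close>.\<close>
  have base_move: "base_point G (move e) = \<rho> (fst (fst e))" if e: "e \<in> topspace (subtopology P D)" for e
  proof -
    obtain x where x: "x \<in> arrows G" "grng G x = \<rho> (fst (fst e))" "gsrc G x = \<rho> (snd (fst e))"
      using RG[OF e] by (auto simp: RG_def orbit_pair_def)
    have "isotropy_subgroup G (gsrc G x) (pull e)"
      using G.closed_subgroupD(3) pull[OF e] x(3) by metis
    then have sub: "pull e \<subseteq> isotropy G (gsrc G x)" "gsrc G x \<in> pull e"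
      by (auto simp: isotropy_subgroup_def)
    have "move e = conjugate G x (pull e)"
      using G.orbit_relation_act_eq[OF ab x(1) sub(1)] x by (simp add: move_def orbit_pair_def)
    then have "move e \<subseteq> isotropy G (grng G x)" "move e \<noteq> {}"
      using G.conjugate_isotropy[OF x(1) sub(1)] sub(2) by (auto simp: conjugate_def)
    then obtain a where "a \<in> move e" "grng G a = grng G x"
      by (auto simp: isotropy_def)
    moreover have "move e \<in> closed_subgroups G"
      using cont_move e G.topspace_subgroup_space by (auto simp: continuous_map_def)
    ultimately show ?thesis
      using G.base_point_eq_rng[of "move e" a] x(2) by simp
  qed
  have "continuous_map (subtopology P D)
      (subtopology (prod_topology Z (subgroup_space G)) {(z, A). base_point G A = \<rho> z}) (\<lambda>e. (fst (fst e), move e))"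
    using base_move by (intro continuous_map_into_subtopology continuous_map_pairedI cont_z cont_move) auto
  from continuous_map_compose[OF this continuous_transport_subgroups]
  have "continuous_map (subtopology P D) (subgroup_space H) (\<lambda>e. transport (fst (fst e)) ` move e)"
    by (simp add: o_def)
  then have "continuous_map (subtopology P D) (subgroup_space H) ((\<lambda>(e, B). orbit_relation_act H e B) \<circ> q)"
  proof (rule continuous_map_eq)
    fix e assume e: "e \<in> topspace (subtopology P D)"
    obtain z w B where e_eq: "e = ((z, w), B)"
      by (cases e) auto
    have zwB: "z \<in> topspace Z" "w \<in> topspace Z" "B \<in> closed_subgroups H" "base_point H B = \<sigma> w"
      using top_D e e_eq by blast+
    have "B \<subseteq> isotropy H (\<sigma> w)"
      using H.closed_subgroupD(3)[OF zwB(3)] zwB(4) by (simp add: isotropy_subgroup_def)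
    then have B: "transport w ` pull e = B" and sub: "pull e \<subseteq> isotropy G (\<rho> w)"
      using transport_cotransport[OF zwB(2)] by (force simp: pull_def e_eq image_image)+
    have "transport z ` move e = orbit_relation_act H (\<sigma> z, \<sigma> w) (transport w ` pull e)"
      using orbit_relation_act_transport[OF ab zwB(1,2) _ sub] RG[OF e] by (simp add: RG_def move_def e_eq)
    then show "transport (fst (fst e)) ` move e = ((\<lambda>(e, B). orbit_relation_act H e B) \<circ> q) e"
      by (simp add: B) (simp add: e_eq q_def)
  qed
  from continuous_compose_quotient_map[OF quot this]
  show ?thesis
    by (simp add: orbit_relation_acts_continuously_def EH_def)
qed

lemma proper_modulo_isotropy_transfer:
  "proper_modulo_isotropy G \<Longrightarrow> proper_modulo_isotropy H"
  by (simp add: proper_modulo_isotropy_def abelian_isotropy_transfer Hausdorff_orbit_space_transfer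
      orbit_relation_acts_continuously_transfer)

end

theorem theorem4p8:
  fixes G :: "'g groupoid" and H :: "'h groupoid" and Z :: "'z topology"
    and \<rho> :: "'z \<Rightarrow> 'g" and lact :: "'g \<Rightarrow> 'z \<Rightarrow> 'z"
    and \<sigma> :: "'z \<Rightarrow> 'h" and ract :: "'z \<Rightarrow> 'h \<Rightarrow> 'z"
  assumes "lch_open_groupoid G" and "lch_open_groupoid H"
    and "groupoid_equivalence G H Z \<rho> lact \<sigma> ract"
    and "abelian_isotropy G"
  shows "abelian_isotropy H \<and> (proper_modulo_isotropy G \<longleftrightarrow> proper_modulo_isotropy H)"
proof -
  interpret lch_groupoid_equivalence G H Z \<rho> lact \<sigma> ract
    by (rule lch_groupoid_equivalence.intro[OF assms(1-3)])
  show ?thesis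
    using abelian_isotropy_transfer[OF assms(4)] proper_modulo_isotropy_transfer
      lch_groupoid_equivalence.proper_modulo_isotropy_transfer[OF opposite] by blast
qed

end
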